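(* Let $E$ be a Banach space, let $1\le p<\infty$ and $\lambda=\ell_p$. Taking $X=\ell_p^w(\cdot)$ and $Y=\ell_{p^*}(\cdot)$ in the definition of the norm $\alpha_{\ell_p}$ on $E\otimes\ell_p$, one has the isometric isomorphism $$(\ell_p^{\rm mid})^u(E)\stackrel{1}{=}E\widehat\otimes_{\alpha_{\ell_p}}\ell_p.$$
   Context: Banach spaces are over $\mathbb K=\mathbb R$ or $\mathbb C$; $E'$ is the topological dual of $E$, $B_E$ the closed unit ball of $E$; $\stackrel{1}{=}$ means isometrically isomorphic; $1/p+1/p^*=1$, with $p^*=\infty$ if $p=1$. $\ell_p^w(E)$ is the Banach space of weakly $p$-summable sequences: $(x_j)_{j=1}^\infty\in E^{\mathbb N}$ with $\|(x_j)_{j=1}^\infty\|_{w,p}=\sup_{\varphi\in B_{E'}}\|(\varphi(x_j))_{j=1}^\infty\|_p<\infty$. $\ell_{p^*}(F)$ is the Banach space of absolutely $p^*$-summable $F$-valued sequences (bounded sequences with the sup norm if $p^*=\infty$). $\ell_p^{\rm mid}(E)$ is the Banach space of mid $p$-summable sequences: those $(x_j)_{j=1}^\infty\in E^{\mathbb N}$ with $$\|(x_j)_{j=1}^\infty\|_{p,{\rm mid}}=\sup_{(\varphi_n)_{n=1}^\infty\in B_{\ell_p^w(E')}}\left(\sum_{n=1}^\infty\sum_{j=1}^\infty|\varphi_n(x_j)|^p\right)^{1/p}<\infty.$$ $(\ell_p^{\rm mid})^u(E)=\{(x_j)_{j=1}^\infty\in\ell_p^{\rm mid}(E):\lim_n\|(x_n,x_{n+1},\ldots)\|_{p,{\rm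 mid}}=0\}$, with the norm $\|\cdot\|_{p,{\rm mid}}$. For $u=\sum_{j=1}^k x_j\otimes y_j\in E\otimes\ell_p$, with $X=\ell_p^w(\cdot)$ and $Y=\ell_{p^*}(\cdot)$ (and identifying $(\ell_p)'$ with $\ell_{p^*}$), $$\alpha_{\ell_p}(u)=\sup\left\{\left|\sum_{j=1}^k\sum_{n=1}^\infty\varphi_n(x_j)\psi_n(y_j)\right| : (\varphi_n)_{n=1}^\infty\in B_{\ell_p^w(E')},\ (\psi_n)_{n=1}^\infty\in B_{\ell_{p^*}(\ell_{p^*})}\right\},$$ which is a norm on $E\otimes\ell_p$ independent of the representation of $u$; $E\widehat\otimes_{\alpha_{\ell_p}}\ell_p$ is the completion of $(E\otimes\ell_p,\alpha_{\ell_p})$. *)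

theory Defs
  imports "HOL-Analysis.Analysis" "HOL-Library.Poly_Mapping"
begin

section \<open>Scalars and Banach spaces\<close>

text \<open>A class whose instances are exactly (isometric copies of) the fields of real and of complex
  numbers, so that both cases are treated at once.\<close>

class real_or_complex = real_normed_field + complete_space +
  assumes ex_real_or_complex:
    "\<exists>f :: 'a \<Rightarrow> complex. (\<forall>x y. f (x + y) = f x + f y) \<and> (\<forall>x y. f (x * y) = f x * f y) \<and>
       (\<forall>r x. f (r *\<^sub>R x) = r *\<^sub>R f x) \<and> (\<forall>x. norm (f x) = norm x) \<and>
       (range f = \<real> \<or> range f = UNIV)"

instance real :: real_or_complex
proof
  show "\<exists>f :: real \<Rightarrow> complex. (\<forall>x y. f (x + y) = f x + f y) \<and> (\<forall>x y. f (x * y) = f x * f y) \<and>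
       (\<forall>r x. f (r *\<^sub>R x) = r *\<^sub>R f x) \<and> (\<forall>x. norm (f x) = norm x) \<and>
       (range f = \<real> \<or> range f = UNIV)"
    by (rule exI[of _ complex_of_real]) (simp add: Reals_def scaleR_conv_of_real)
qed

instance complex :: real_or_complex
proof
  show "\<exists>f :: complex \<Rightarrow> complex. (\<forall>x y. f (x + y) = f x + f y) \<and> (\<forall>x y. f (x * y) = f x * f y) \<and>
       (\<forall>r x. f (r *\<^sub>R x) = r *\<^sub>R f x) \<and> (\<forall>x. norm (f x) = norm x) \<and>
       (range f = \<real> \<or> range f = UNIV)"
    by (rule exI[of _ "\<lambda>z. z"]) simp
qed

text \<open>The type class \<open>banach\<close> only knows real scalars; a Banach space over the scalar field
  is a type of that class with a compatible scalar multiplication.\<close>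

locale banach_space_over = vector_space scaleK
  for scaleK :: "'k::real_or_complex \<Rightarrow> 'e::banach \<Rightarrow> 'e" +
  assumes norm_scaleK: "norm (scaleK c x) = norm c * norm x"
    and scaleK_of_real: "scaleK (of_real r) x = r *\<^sub>R x"

lemma banach_space_over_scaleR: "banach_space_over (scaleR :: real \<Rightarrow> 'e::banach \<Rightarrow> 'e)"
  by unfold_locales (auto simp: algebra_simps)

lemma banach_space_over_mult:
  "banach_space_over ((*) :: complex \<Rightarrow> complex \<Rightarrow> complex)"
  by unfold_locales (auto simp: algebra_simps norm_mult scaleR_conv_of_real)

text \<open>The spaces built from \<open>E\<close> depend on \<open>p\<close> or are quotients, so they are given by
  explicit carriers and operations. The record carries no axioms.\<close>

record ('k, 'a) nspace =
  carrier :: "'a set"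
  vadd :: "'a \<Rightarrow> 'a \<Rightarrow> 'a"
  vscale :: "'k \<Rightarrow> 'a \<Rightarrow> 'a"
  vnorm :: "'a \<Rightarrow> real"

definition nspace_of :: "('k \<Rightarrow> 'e \<Rightarrow> 'e) \<Rightarrow> ('k, 'e::real_normed_vector) nspace" where
  "nspace_of scaleK = \<lparr>carrier = UNIV, vadd = (+), vscale = scaleK, vnorm = norm\<rparr>"

abbreviation scalars :: "('k, 'k::real_or_complex) nspace" where
  "scalars \<equiv> nspace_of (*)"

definition unit_ball :: "('k, 'a) nspace \<Rightarrow> 'a set" where
  "unit_ball V = {x \<in> carrier V. vnorm V x \<le> 1}"

text \<open>Functionals on \<open>V\<close> are normalised to be \<open>undefined\<close> outside the carrier, so that equality
  of functionals is equality of HOL functions; nothing changes when the carrier is \<open>UNIV\<close>.\<close>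

definition dual :: "('k::real_or_complex, 'a) nspace \<Rightarrow> ('k, 'a \<Rightarrow> 'k) nspace" where
  "dual V = \<lparr>
     carrier = {\<phi> \<in> extensional (carrier V).
        (\<forall>x \<in> carrier V. \<forall>y \<in> carrier V. \<phi> (vadd V x y) = \<phi> x + \<phi> y) \<and>
        (\<forall>c. \<forall>x \<in> carrier V. \<phi> (vscale V c x) = c * \<phi> x) \<and>
        (\<exists>C. \<forall>x \<in> carrier V. norm (\<phi> x) \<le> C * vnorm V x)},
     vadd = (\<lambda>\<phi> \<psi>. restrict (\<lambda>x. \<phi> x + \<psi> x) (carrier V)),
     vscale = (\<lambda>c \<phi>. restrict (\<lambda>x. c * \<phi> x) (carrier V)),
     vnorm = (\<lambda>\<phi>. SUP x \<in> unit_ball V. norm (\<phi> x))\<rparr>"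

definition isometrically_isomorphic :: "('k, 'a) nspace \<Rightarrow> ('k, 'b) nspace \<Rightarrow> bool" where
  "isometrically_isomorphic V W \<longleftrightarrow>
     (\<exists>T. bij_betw T (carrier V) (carrier W) \<and>
        (\<forall>x \<in> carrier V. \<forall>y \<in> carrier V. T (vadd V x y) = vadd W (T x) (T y)) \<and>
        (\<forall>c. \<forall>x \<in> carrier V. T (vscale V c x) = vscale W c (T x)) \<and>
        (\<forall>x \<in> carrier V. vnorm W (T x) = vnorm V x))"


section \<open>Sequence spaces\<close>

definition ennreal_powr :: "ennreal \<Rightarrow> real \<Rightarrow> ennreal" where
  "ennreal_powr a r = (if a = \<infinity> then \<infinity> else ennreal (enn2real a powr r))"

text \<open>The conjugate exponent. Exponents of \<open>\<ell>\<^sub>q\<close>-norms are of type \<open>ennreal\<close> so that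
  \<open>q = \<infinity>\<close> is allowed.\<close>

definition conj_exp :: "real \<Rightarrow> ennreal" where
  "conj_exp p = (if p = 1 then \<infinity> else ennreal (p / (p - 1)))"

text \<open>Infinite sums are written with \<open>suminf\<close>, because the sum syntax is also claimed by \<open>Sum_any\<close>.
  Norms of sequences are first defined with values in \<open>[0, \<infinity>]\<close>; the spaces consist of the
  sequences for which the value is finite.\<close>

definition lp_norm :: "ennreal \<Rightarrow> (nat \<Rightarrow> real) \<Rightarrow> ennreal" where
  "lp_norm q a = (if q = \<infinity> then (SUP j. ennreal \<bar>a j\<bar>)
     else ennreal_powr (suminf (\<lambda>j. ennreal (\<bar>a j\<bar> powr enn2real q))) (1 / enn2real q))"

definition seq_space ::
    "('k, 'a) nspace \<Rightarrow> (nat \<Rightarrow> 'a) set \<Rightarrow> ((nat \<Rightarrow> 'a) \<Rightarrow> real) \<Rightarrow> ('k, nat \<Rightarrow> 'a) nspace" where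
  "seq_space V S N = \<lparr>carrier = S, vadd = (\<lambda>x y j. vadd V (x j) (y j)),
     vscale = (\<lambda>c x j. vscale V c (x j)), vnorm = N\<rparr>"

definition ell_norm :: "ennreal \<Rightarrow> ('k, 'a) nspace \<Rightarrow> (nat \<Rightarrow> 'a) \<Rightarrow> ennreal" where
  "ell_norm q V x = lp_norm q (\<lambda>j. vnorm V (x j))"

definition ell :: "ennreal \<Rightarrow> ('k, 'a) nspace \<Rightarrow> ('k, nat \<Rightarrow> 'a) nspace" where
  "ell q V = seq_space V {x. range x \<subseteq> carrier V \<and> ell_norm q V x < \<infinity>}
     (\<lambda>x. enn2real (ell_norm q V x))"

definition weak_norm :: "real \<Rightarrow> ('k::real_or_complex, 'a) nspace \<Rightarrow> (nat \<Rightarrow> 'a) \<Rightarrow> ennreal" where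
  "weak_norm p V x = (SUP \<phi> \<in> unit_ball (dual V). lp_norm (ennreal p) (\<lambda>j. norm (\<phi> (x j))))"

definition ell_weak :: "real \<Rightarrow> ('k::real_or_complex, 'a) nspace \<Rightarrow> ('k, nat \<Rightarrow> 'a) nspace" where
  "ell_weak p V = seq_space V {x. range x \<subseteq> carrier V \<and> weak_norm p V x < \<infinity>}
     (\<lambda>x. enn2real (weak_norm p V x))"

definition mid_norm :: "real \<Rightarrow> ('k::real_or_complex, 'a) nspace \<Rightarrow> (nat \<Rightarrow> 'a) \<Rightarrow> ennreal" where
  "mid_norm p V x = (SUP \<phi> \<in> unit_ball (ell_weak p (dual V)).
     ennreal_powr (suminf (\<lambda>n. suminf (\<lambda>j. ennreal (norm (\<phi> n (x j)) powr p)))) (1 / p))"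

definition ell_mid :: "real \<Rightarrow> ('k::real_or_complex, 'a) nspace \<Rightarrow> ('k, nat \<Rightarrow> 'a) nspace" where
  "ell_mid p V = seq_space V {x. range x \<subseteq> carrier V \<and> mid_norm p V x < \<infinity>}
     (\<lambda>x. enn2real (mid_norm p V x))"

definition ell_mid_u :: "real \<Rightarrow> ('k::real_or_complex, 'a) nspace \<Rightarrow> ('k, nat \<Rightarrow> 'a) nspace" where
  "ell_mid_u p V = seq_space V
     {x \<in> carrier (ell_mid p V). (\<lambda>n. vnorm (ell_mid p V) (\<lambda>j. x (n + j))) \<longlonglongrightarrow> 0}
     (vnorm (ell_mid p V))"


section \<open>The algebraic tensor product\<close>

text \<open>Finitely supported functions on pairs form the free vector space on the pairs; the tensor
  product is its quotient by the bilinearity relations, its elements being cosets.\<close>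

definition free_scale :: "'k::field \<Rightarrow> ('a \<Rightarrow>\<^sub>0 'k) \<Rightarrow> ('a \<Rightarrow>\<^sub>0 'k)" where
  "free_scale c f = Poly_Mapping.map (\<lambda>a. c * a) f"

lemma lookup_free_scale: "Poly_Mapping.lookup (free_scale c f) k = c * Poly_Mapping.lookup f k"
  unfolding free_scale_def by transfer (simp add: when_def)

interpretation free: vector_space free_scale
  by unfold_locales
    (auto intro!: poly_mapping_eqI simp: lookup_free_scale lookup_add algebra_simps)

abbreviation gen :: "'a \<Rightarrow> 'b \<Rightarrow> (('a \<times> 'b) \<Rightarrow>\<^sub>0 'k::field)" where
  "gen x y \<equiv> Poly_Mapping.single (x, y) 1"

definition free_on :: "('k::field, 'a) nspace \<Rightarrow> ('k, 'b) nspace \<Rightarrow> (('a \<times> 'b) \<Rightarrow>\<^sub>0 'k) set" where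
  "free_on V W = {f. Poly_Mapping.keys f \<subseteq> carrier V \<times> carrier W}"

definition bilinear_relations ::
    "('k::field, 'a) nspace \<Rightarrow> ('k, 'b) nspace \<Rightarrow> (('a \<times> 'b) \<Rightarrow>\<^sub>0 'k) set" where
  "bilinear_relations V W =
     {gen (vadd V x x') y - gen x y - gen x' y | x x' y.
        x \<in> carrier V \<and> x' \<in> carrier V \<and> y \<in> carrier W} \<union>
     {gen x (vadd W y y') - gen x y - gen x y' | x y y'.
        x \<in> carrier V \<and> y \<in> carrier W \<and> y' \<in> carrier W} \<union>
     {gen (vscale V c x) y - free_scale c (gen x y) | c x y. x \<in> carrier V \<and> y \<in> carrier W} \<union>
     {gen x (vscale W c y) - free_scale c (gen x y) | c x y. x \<in> carrier V \<and> y \<in> carrier W}"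

definition tensor_class ::
    "('k::field, 'a) nspace \<Rightarrow> ('k, 'b) nspace \<Rightarrow> (('a \<times> 'b) \<Rightarrow>\<^sub>0 'k) \<Rightarrow> (('a \<times> 'b) \<Rightarrow>\<^sub>0 'k) set" where
  "tensor_class V W f = {f + r | r. r \<in> free.span (bilinear_relations V W)}"

text \<open>\<open>V \<otimes> W\<close> with a prescribed function \<open>N\<close> as its norm.\<close>

definition tensor_space :: "('k::field, 'a) nspace \<Rightarrow> ('k, 'b) nspace \<Rightarrow>
    ((('a \<times> 'b) \<Rightarrow>\<^sub>0 'k) set \<Rightarrow> real) \<Rightarrow> ('k, (('a \<times> 'b) \<Rightarrow>\<^sub>0 'k) set) nspace" where
  "tensor_space V W N = \<lparr>
     carrier = tensor_class V W ` free_on V W,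
     vadd = (\<lambda>u v. \<Union>f \<in> u. \<Union>g \<in> v. tensor_class V W (f + g)),
     vscale = (\<lambda>c u. \<Union>f \<in> u. tensor_class V W (free_scale c f)),
     vnorm = N\<rparr>"

text \<open>A list \<open>[(x\<^sub>1, y\<^sub>1), \<dots>, (x\<^sub>k, y\<^sub>k)]\<close> represents the tensor
  \<open>x\<^sub>1 \<otimes> y\<^sub>1 + \<dots> + x\<^sub>k \<otimes> y\<^sub>k\<close>.\<close>

definition represents :: "('k::field, 'a) nspace \<Rightarrow> ('k, 'b) nspace \<Rightarrow>
    ('a \<times> 'b) list \<Rightarrow> (('a \<times> 'b) \<Rightarrow>\<^sub>0 'k) set \<Rightarrow> bool" where
  "represents V W zs u \<longleftrightarrow> set zs \<subseteq> carrier V \<times> carrier W \<and>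
     u = tensor_class V W (\<Sum>(x, y) \<leftarrow> zs. gen x y)"


section \<open>The norm \<open>\<alpha>\<close> and the completion\<close>

text \<open>The identification of \<open>\<ell>\<^sub>p\<^sub>*\<close> with the dual of \<open>\<ell>\<^sub>p\<close>.\<close>

definition pairing :: "(nat \<Rightarrow> 'k::real_or_complex) \<Rightarrow> (nat \<Rightarrow> 'k) \<Rightarrow> 'k" where
  "pairing b y = suminf (\<lambda>i. b i * y i)"

definition alpha_of_list :: "real \<Rightarrow> ('k::real_or_complex, 'a) nspace \<Rightarrow>
    ('a \<times> (nat \<Rightarrow> 'k)) list \<Rightarrow> real" where
  "alpha_of_list p V zs =
     (SUP (\<phi>, \<psi>) \<in> unit_ball (ell_weak p (dual V)) \<times>
                    unit_ball (ell (conj_exp p) (ell (conj_exp p) scalars)).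
        norm (\<Sum>(x, y) \<leftarrow> zs. suminf (\<lambda>n. \<phi> n x * pairing (\<psi> n) y)))"

text \<open>The value does not depend on the representation chosen.\<close>

definition alpha :: "real \<Rightarrow> ('k::real_or_complex, 'a) nspace \<Rightarrow>
    (('a \<times> (nat \<Rightarrow> 'k)) \<Rightarrow>\<^sub>0 'k) set \<Rightarrow> real" where
  "alpha p V u = alpha_of_list p V (SOME zs. represents V (ell (ennreal p) scalars) zs u)"

definition alpha_tensor :: "real \<Rightarrow> ('k::real_or_complex, 'a) nspace \<Rightarrow>
    ('k, (('a \<times> (nat \<Rightarrow> 'k)) \<Rightarrow>\<^sub>0 'k) set) nspace" where
  "alpha_tensor p V = tensor_space V (ell (ennreal p) scalars) (alpha p V)"

text \<open>The completion consists of the Cauchy sequences modulo null sequences.\<close>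

definition vdist :: "('k::field, 'a) nspace \<Rightarrow> 'a \<Rightarrow> 'a \<Rightarrow> real" where
  "vdist V x y = vnorm V (vadd V x (vscale V (- 1) y))"

definition cauchy_seqs :: "('k::field, 'a) nspace \<Rightarrow> (nat \<Rightarrow> 'a) set" where
  "cauchy_seqs V = {s. range s \<subseteq> carrier V \<and>
     (\<forall>e > 0. \<exists>N. \<forall>m \<ge> N. \<forall>n \<ge> N. vdist V (s m) (s n) < e)}"

definition cauchy_class :: "('k::field, 'a) nspace \<Rightarrow> (nat \<Rightarrow> 'a) \<Rightarrow> (nat \<Rightarrow> 'a) set" where
  "cauchy_class V s = {t \<in> cauchy_seqs V. (\<lambda>n. vdist V (s n) (t n)) \<longlonglongrightarrow> 0}"

definition completion_of :: "('k::field, 'a) nspace \<Rightarrow> ('k, (nat \<Rightarrow> 'a) set) nspace" where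
  "completion_of V = \<lparr>
     carrier = cauchy_class V ` cauchy_seqs V,
     vadd = (\<lambda>S T. \<Union>s \<in> S. \<Union>t \<in> T. cauchy_class V (\<lambda>n. vadd V (s n) (t n))),
     vscale = (\<lambda>c S. \<Union>s \<in> S. cauchy_class V (\<lambda>n. vscale V c (s n))),
     vnorm = (\<lambda>S. lim (\<lambda>n. vnorm V ((SOME s. s \<in> S) n)))\<rparr>"

end

theory Submission
  imports Defs
begin

text \<open>
  Send a finite tensor \<open>u = x\<^sub>1 \<otimes> y\<^sub>1 + \<dots> + x\<^sub>k \<otimes> y\<^sub>k\<close> to the sequence \<open>J u\<close> in \<open>E\<close> whose
  \<open>j\<close>-th term is \<open>y\<^sub>1(j) x\<^sub>1 + \<dots> + y\<^sub>k(j) x\<^sub>k\<close>. The map \<open>J\<close> is the isomorphism, up to completion.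

  Written out, the scalar under the supremum that defines \<open>\<alpha>(u)\<close> is the double series
  \<open>\<Sum>\<^sub>n \<Sum>\<^sub>j \<psi>\<^sub>n(j) \<phi>\<^sub>n((J u)\<^sub>j)\<close>. The unit ball of \<open>\<ell>\<^sub>p\<^sub>*(\<ell>\<^sub>p\<^sub>*)\<close>, over which \<open>\<psi>\<close> ranges, is the unit ball
  of \<open>\<ell>\<^sub>p\<^sub>*\<close> over pairs of indices, so for fixed \<open>\<phi>\<close> the duality of \<open>\<ell>\<^sub>p\<close> and \<open>\<ell>\<^sub>p\<^sub>*\<close> makes the
  supremum over \<open>\<psi>\<close> the \<open>\<ell>\<^sub>p\<close>-norm of the double sequence \<open>\<phi>\<^sub>n((J u)\<^sub>j)\<close>, and the supremum of
  these norms over \<open>\<phi>\<close> is the mid norm of \<open>J u\<close>. Hence \<open>J\<close> is isometric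
  (\<open>alpha_of_list_eq_mid_norm\<close>); it is well defined on tensors because \<open>(x, y) \<mapsto> (y(j) x)\<^sub>j\<close> is
  bilinear (\<open>tensor_seq_class\<close>).

  The values of \<open>J\<close> are mid summable sequences with tails of arbitrarily small norm, because the tail of
  \<open>(y(j) x)\<^sub>j\<close> is governed by the tail of the convergent series \<open>\<Sum>\<^sub>j |y(j)|\<^sup>p\<close>
  (\<open>elementary_in_ell_mid_u\<close>). They are dense among these sequences: the truncation of \<open>x\<close> to its first
  \<open>n\<close> terms is \<open>J(x\<^sub>0 \<otimes> e\<^sub>0 + \<dots> + x\<^sub>n\<^sub>-\<^sub>1 \<otimes> e\<^sub>n\<^sub>-\<^sub>1)\<close>, and its distance to \<open>x\<close> is the norm of a tail
  (\<open>truncations_converge\<close>).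

  What remains is that the space of these sequences is complete (\<open>ell_mid_u_complete\<close>). By the same duality the mid
  norm is a supremum of moduli of linear functionals that depend continuously on finitely many terms
  of the sequence, so that a bound on it survives termwise limits; and
  the terms of a Cauchy sequence converge because \<open>norm (x j)\<close> is at most the mid norm of \<open>x\<close>. The
  latter uses the Hahn--Banach theorem, proved here for real scalars by minimising sublinear functions
  and transferred to complex scalars. A complete space into which a space \<open>W\<close> maps linearly and isometrically
  with dense range is the completion of \<open>W\<close> (\<open>isometric_completion\<close>).
\<close>


section \<open>The Hahn--Banach theorem by minimal sublinear functionals\<close>

text \<open>Homogeneity is asked for as an inequality because in this form it passes directly to infima;
  equality follows in \<open>sublinear_scaleR\<close>.\<close>

definition sublinear :: "('e::real_vector \<Rightarrow> real) \<Rightarrow> bool" where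
  "sublinear q \<longleftrightarrow> (\<forall>x y. q (x + y) \<le> q x + q y) \<and> (\<forall>t>0. \<forall>x. q (t *\<^sub>R x) \<le> t * q x)"

lemma sublinear_scaleR:
  assumes "sublinear q" "t \<ge> 0"
  shows "q (t *\<^sub>R x) = t * q x"
proof (cases "t = 0")
  case True
  have "q 0 \<le> q 0 + q 0"
    using assms(1) unfolding sublinear_def by (metis add.right_neutral)
  moreover have "q 0 \<le> (1/2) * q 0"
    using assms(1)[unfolded sublinear_def, THEN conjunct2, rule_format, of "1/2" 0] by simp
  ultimately show ?thesis using True by simp
next
  case False
  then have t: "t > 0" using assms by simp
  have "q (inverse t *\<^sub>R (t *\<^sub>R x)) \<le> inverse t * q (t *\<^sub>R x)"
    using assms(1) t unfolding sublinear_def by (meson positive_imp_inverse_positive)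
  then have "t * q x \<le> q (t *\<^sub>R x)" using t by (simp add: field_simps)
  moreover have "q (t *\<^sub>R x) \<le> t * q x" using assms(1) t unfolding sublinear_def by blast
  ultimately show ?thesis by simp
qed

lemma sublinear_zero: "sublinear q \<Longrightarrow> q 0 = 0"
  using sublinear_scaleR[of q 0 0] by simp

lemma sublinear_lower_bound: "sublinear q \<Longrightarrow> q y - q (- x) \<le> q (x + y)"
  unfolding sublinear_def using sublinear_zero
  by (metis add.commute diff_le_eq minus_add_cancel)

text \<open>The function \<open>r y = inf\<^sub>t\<^sub>\<ge>\<^sub>0 (q (y + t z) - t q z)\<close> lies below \<open>q\<close>, by \<open>t = 0\<close>, and the choice
  \<open>t = 1\<close> makes it strictly smaller somewhere unless \<open>q (y + z) = q y + q z\<close> for all \<open>y\<close>. So it is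
  the device that improves a sublinear function which is not yet linear. It also takes the
  value \<open>- q z\<close> or less at \<open>- z\<close>, which later forces functionals to be norming.\<close>

lemma sublinear_directional:
  assumes q: "sublinear q"
  obtains r where "sublinear r" "\<And>y. r y \<le> q y" "\<And>y. r y \<le> q (y + z) - q z"
proof -
  define g where "g y t = q (y + t *\<^sub>R z) - t * q z" for y t
  define r where "r y = (INF t\<in>{0..}. g y t)" for y
  have lb: "- q (- y) \<le> g y t" if "t \<ge> 0" for y t
    using sublinear_lower_bound[OF q, of "t *\<^sub>R z" y] sublinear_scaleR[OF q that, of z]
    by (simp add: g_def)
  have bdd: "bdd_below (g y ` {0..})" for y
    by (rule bdd_belowI[of _ "- q (- y)"]) (use lb in auto)
  have r_le: "r y \<le> g y t" if "t \<ge> 0" for y t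
    unfolding r_def by (rule cINF_lower[OF bdd]) (use that in auto)
  have le_r: "c \<le> r y" if "\<And>t. t \<ge> 0 \<Longrightarrow> c \<le> g y t" for c y
    unfolding r_def by (rule cINF_greatest) (use that in auto)
  have "r (x + y) \<le> r x + r y" for x y
  proof -
    have *: "r (x + y) \<le> g x s + g y t" if "s \<ge> 0" "t \<ge> 0" for s t
    proof -
      have "q (x + y + (s + t) *\<^sub>R z) = q ((x + s *\<^sub>R z) + (y + t *\<^sub>R z))"
        by (simp add: algebra_simps)
      also have "\<dots> \<le> q (x + s *\<^sub>R z) + q (y + t *\<^sub>R z)"
        using q unfolding sublinear_def by blast
      finally have "g (x + y) (s + t) \<le> g x s + g y t"
        by (simp add: g_def algebra_simps)
      then show ?thesis using r_le[of "s + t" "x + y"] that by simp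
    qed
    have "r (x + y) - g y t \<le> r x" if "t \<ge> 0" for t
      by (rule le_r) (use * that in \<open>simp add: algebra_simps\<close>)
    then have "r (x + y) - r x \<le> r y"
      by (intro le_r) (simp add: algebra_simps)
    then show ?thesis by simp
  qed
  moreover have "r (s *\<^sub>R y) \<le> s * r y" if s: "s > 0" for s y
  proof -
    have "r (s *\<^sub>R y) / s \<le> g y t" if t: "t \<ge> 0" for t
    proof -
      have "q (s *\<^sub>R y + (s * t) *\<^sub>R z) = s * q (y + t *\<^sub>R z)"
        using sublinear_scaleR[OF q, of s "y + t *\<^sub>R z"] s by (simp add: scaleR_add_right)
      then have "g (s *\<^sub>R y) (s * t) = s * g y t"
        by (simp add: g_def algebra_simps)
      then have "r (s *\<^sub>R y) \<le> s * g y t"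
        using r_le[of "s * t" "s *\<^sub>R y"] s t by simp
      then show ?thesis using s by (simp add: field_simps)
    qed
    then have "r (s *\<^sub>R y) / s \<le> r y" by (rule le_r)
    then show ?thesis using s by (simp add: field_simps)
  qed
  ultimately have "sublinear r" unfolding sublinear_def by blast
  moreover have "r y \<le> q y" for y using r_le[of 0 y] by (simp add: g_def)
  moreover have "r y \<le> q (y + z) - q z" for y using r_le[of 1 y] by (simp add: g_def)
  ultimately show ?thesis by (rule that)
qed

text \<open>The infimum is finite since every member of the chain is bounded below by \<open>- P (- x)\<close>, and
  it is subadditive since two members of the chain can both be replaced by the smaller one.\<close>

lemma sublinear_chain_Inf:
  assumes "C \<noteq> {}"
    and sub: "\<And>q. q \<in> C \<Longrightarrow> sublinear q \<and> (\<forall>x. q x \<le> P x)"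
    and chain: "\<And>q r. q \<in> C \<Longrightarrow> r \<in> C \<Longrightarrow> q \<le> r \<or> r \<le> q"
  obtains u where "sublinear u" "\<And>q x. q \<in> C \<Longrightarrow> u x \<le> q x"
proof -
  define u where "u x = (INF q\<in>C. q x)" for x
  have bdd: "bdd_below ((\<lambda>q. q x) ` C)" for x
  proof (rule bdd_belowI2[of _ "- P (- x)"])
    fix q assume "q \<in> C"
    with sub have "sublinear q" "q (- x) \<le> P (- x)" by auto
    then show "- P (- x) \<le> q x"
      using sublinear_lower_bound[of q 0 x] sublinear_zero[of q] by simp
  qed
  have u_le: "u x \<le> q x" if "q \<in> C" for q x
    unfolding u_def by (rule cINF_lower[OF bdd that])
  have le_u: "c \<le> u x" if "\<And>q. q \<in> C \<Longrightarrow> c \<le> q x" for c x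
    unfolding u_def by (rule cINF_greatest[OF assms(1) that])
  have "u (x + y) \<le> u x + u y" for x y
  proof -
    have *: "u (x + y) \<le> q x + r y" if qr: "q \<in> C" "r \<in> C" for q r
    proof -
      obtain m where m: "m \<in> C" "m \<le> q" "m \<le> r" using chain[OF qr] qr by blast
      have "u (x + y) \<le> m x + m y"
        using u_le[OF m(1), of "x + y"] sub[OF m(1)] unfolding sublinear_def
        by (meson order_trans)
      also have "\<dots> \<le> q x + r y" using m by (intro add_mono) (auto simp: le_fun_def)
      finally show ?thesis .
    qed
    have "u (x + y) - r y \<le> u x" if "r \<in> C" for r
      by (rule le_u) (use * that in \<open>simp add: algebra_simps\<close>)
    then have "u (x + y) - u x \<le> u y" by (intro le_u) (simp add: algebra_simps)
    then show ?thesis by simp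
  qed
  moreover have "u (t *\<^sub>R x) \<le> t * u x" if t: "t > 0" for t x
  proof -
    have "u (t *\<^sub>R x) / t \<le> u x"
    proof (rule le_u)
      fix q assume q: "q \<in> C"
      then have "u (t *\<^sub>R x) \<le> t * q x"
        using u_le[OF q, of "t *\<^sub>R x"] sub[OF q] sublinear_scaleR[of q t x] t by simp
      then show "u (t *\<^sub>R x) / t \<le> q x" using t by (simp add: field_simps)
    qed
    then show ?thesis using t by (simp add: field_simps)
  qed
  ultimately have "sublinear u" unfolding sublinear_def by blast
  then show ?thesis using that u_le by blast
qed

text \<open>Zorn's lemma provides a minimal sublinear function below \<open>P\<close>. It agrees with each of its
  directional infima, and this says that it is additive.\<close>

theorem Hahn_Banach_sublinear:
  fixes P :: "'e::real_vector \<Rightarrow> real"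
  assumes P: "sublinear P"
  obtains f where "linear f" "\<And>x. f x \<le> P x"
proof -
  define S where "S = {q. sublinear q \<and> (\<forall>x. q x \<le> P x)}"
  have "\<exists>f\<in>S. \<forall>q\<in>S. f \<ge> q \<longrightarrow> q = f"
  proof (rule predicate_Zorn)
    show "partial_order_on S (relation_of (\<ge>) S)"
      by (rule partial_order_on_relation_ofI) auto
  next
    fix C assume C: "C \<in> Chains (relation_of (\<ge>) S)"
    then have CS: "C \<subseteq> S" and chain: "\<And>q r. q \<in> C \<Longrightarrow> r \<in> C \<Longrightarrow> q \<le> r \<or> r \<le> q"
      unfolding Chains_def relation_of_def by auto
    show "\<exists>u\<in>S. \<forall>q\<in>C. u \<le> q"
    proof (cases "C = {}")
      case True
      then show ?thesis using P by (auto simp: S_def)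
    next
      case False
      then obtain u where u: "sublinear u" "\<And>q x. q \<in> C \<Longrightarrow> u x \<le> q x"
        using sublinear_chain_Inf[of C P] CS chain by (auto simp: S_def)
      obtain q where q: "q \<in> C" using False by blast
      have "u x \<le> P x" for x
        using u(2)[OF q, of x] q CS unfolding S_def by (auto intro: order_trans)
      then have "u \<in> S" using u by (auto simp: S_def)
      then show ?thesis using u(2) by (auto simp: le_fun_def)
    qed
  qed
  then obtain f where f: "sublinear f" "\<And>x. f x \<le> P x"
    and min: "\<And>q. sublinear q \<Longrightarrow> (\<forall>x. q x \<le> P x) \<Longrightarrow> q \<le> f \<Longrightarrow> q = f"
    unfolding S_def by auto
  have add: "f (y + z) = f y + f z" for y z
  proof -
    obtain r where r: "sublinear r" "\<And>y. r y \<le> f y" "\<And>y. r y \<le> f (y + z) - f z"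
      using sublinear_directional[OF f(1)] by blast
    have "r = f"
      by (rule min) (use r f in \<open>auto simp: le_fun_def intro: order_trans\<close>)
    then have "f y + f z \<le> f (y + z)" using r(3)[of y] by simp
    moreover have "f (y + z) \<le> f y + f z" using f(1) unfolding sublinear_def by blast
    ultimately show ?thesis by simp
  qed
  have neg: "f (- x) = - f x" for x
    using add[of x "- x"] sublinear_zero[OF f(1)] by simp
  have "f (t *\<^sub>R x) = t * f x" for t x
  proof (cases "t \<ge> 0")
    case False
    then have "f ((- t) *\<^sub>R x) = - t * f x" by (intro sublinear_scaleR[OF f(1)]) simp
    then show ?thesis using neg[of "t *\<^sub>R x"] by simp
  qed (rule sublinear_scaleR[OF f(1)])
  then have "linear f" using add by (intro linearI) auto
  then show ?thesis using that f(2) by blast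
qed

text \<open>The norm is first replaced by its directional infimum at \<open>x\<close>, so that every linear function
  below it has a value of at most \<open>- norm x\<close> at \<open>- x\<close>.\<close>

corollary norming_functional_real:
  fixes x :: "'e::real_normed_vector"
  obtains f :: "'e \<Rightarrow> real" where "linear f" "\<And>y. \<bar>f y\<bar> \<le> norm y" "f x = norm x"
proof -
  have "sublinear (norm :: 'e \<Rightarrow> real)"
    unfolding sublinear_def by (auto intro: norm_triangle_ineq)
  then obtain r where r: "sublinear r" "\<And>y. r y \<le> norm y" "\<And>y. r y \<le> norm (y + x) - norm x"
    using sublinear_directional by blast
  obtain f where f: "linear f" "\<And>y. f y \<le> r y" using Hahn_Banach_sublinear[OF r(1)] by blast
  have le: "f y \<le> norm y" for y using f(2) r(2) by (rule order_trans)
  have "\<bar>f y\<bar> \<le> norm y" for y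
    using le[of y] le[of "- y"] by (simp add: linear_neg[OF f(1)] abs_le_iff)
  moreover have "f x = norm x"
    using f(2)[of "- x"] r(3)[of "- x"] le[of x] by (simp add: linear_neg[OF f(1)])
  ultimately show ?thesis using that f(1) by blast
qed


text \<open>Makes the convergence theory of series in Banach spaces available for scalars.\<close>

subclass (in real_or_complex) banach ..

text \<open>If the scalars are real, the real functional \<open>f\<close> already is one over the scalar field. If they are
  complex, \<open>F y = f y - i f (i y)\<close> is complex linear with real part \<open>f\<close>; multiplying \<open>y\<close> by a
  scalar of modulus one that makes \<open>F y\<close> real and nonnegative shows \<open>norm (F y) \<le> norm y\<close>.\<close>

lemma (in banach_space_over) norming_functional:
  fixes x :: 'e
  obtains F where "\<And>y z. F (y + z) = F y + F z" "\<And>c y. F (scaleK c y) = c * F y"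
    "\<And>y. norm (F y) \<le> norm y" "norm (F x) = norm x"
proof -
  obtain f :: "'e \<Rightarrow> real" where f: "linear f" "\<And>y. \<bar>f y\<bar> \<le> norm y" "f x = norm x"
    using norming_functional_real by blast
  obtain h :: "'k \<Rightarrow> complex" where h: "\<And>a b. h (a + b) = h a + h b"
    "\<And>a b. h (a * b) = h a * h b" "\<And>r a. h (r *\<^sub>R a) = r *\<^sub>R h a"
    "\<And>a. norm (h a) = norm a" "range h = \<real> \<or> range h = UNIV"
    using ex_real_or_complex by blast
  have "h 1 * h 1 = h 1 * 1" using h(2)[of 1 1] by simp
  moreover have "h 1 \<noteq> 0" using h(4)[of 1] by auto
  ultimately have h1: "h 1 = 1" by (metis mult_cancel_left)
  have h_real: "h (of_real r) = of_real r" for r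
    using h(3)[of r 1] h1 by (simp add: of_real_def)
  have h_diff: "h (a - b) = h a - h b" for a b
    using h(1)[of "a - b" b] by simp
  have h_inj: "a = b" if "h a = h b" for a b
    using h(4)[of "a - b"] that by (simp add: h_diff)
  \<comment> \<open>in the real case every scalar is the image of a real number\<close>
  have split: "c = of_real (Re (h c))" if "range h = \<real>" for c
  proof (rule h_inj)
    have "h c \<in> \<real>" using that by auto
    then show "h c = h (of_real (Re (h c)))" by (simp add: h_real of_real_Re)
  qed
  have "\<exists>F. (\<forall>y z. F (y + z) = F y + F z) \<and> (\<forall>c y. F (scaleK c y) = c * F y) \<and>
          (\<forall>y. Re (h (F y)) = f y)"
  proof (cases "range h = \<real>")
    case True
    have "of_real (f (scaleK c y)) = c * of_real (f y)" for c y
    proof -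
      have "scaleK c y = Re (h c) *\<^sub>R y" using split[OF True, of c] scaleK_of_real by metis
      then have "of_real (f (scaleK c y)) = of_real (Re (h c)) * (of_real (f y) :: 'k)"
        by (simp add: linear_scale[OF f(1)])
      then show ?thesis using split[OF True, of c] by simp
    qed
    then show ?thesis
      by (intro exI[of _ "\<lambda>y. of_real (f y)"]) (simp add: linear_add[OF f(1)] h_real)
  next
    case False
    with h(5) obtain j where j: "h j = \<i>" by (metis UNIV_I image_iff)
    have jj: "j * j = - 1"
    proof (rule h_inj)
      have "h (- 1) = - 1" using h_real[of "- 1"] by simp
      then show "h (j * j) = h (- 1)" by (simp add: h(2) j)
    qed
    define F where "F y = of_real (f y) - j * of_real (f (scaleK j y))" for y
    have Fadd: "F (y + z) = F y + F z" for y z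
      by (simp add: F_def scale_right_distrib linear_add[OF f(1)] algebra_simps)
    have Fr: "F (scaleK (of_real r) y) = of_real r * F y" for r y
    proof -
      have "scaleK j (scaleK (of_real r) y) = r *\<^sub>R scaleK j y"
        by (metis scale_left_commute scaleK_of_real)
      then show ?thesis
        by (simp add: F_def scaleK_of_real linear_scale[OF f(1)] algebra_simps)
    qed
    have Fj: "F (scaleK j y) = j * F y" for y
    proof -
      have "scaleK j (scaleK j y) = scaleK (of_real (- 1)) y" by (simp add: jj)
      then have "scaleK j (scaleK j y) = - y" by (simp only: scaleK_of_real) simp
      then have "F (scaleK j y) = of_real (f (scaleK j y)) + j * of_real (f y)"
        by (simp add: F_def linear_neg[OF f(1)])
      also have "\<dots> = j * F y"
        by (simp add: F_def right_diff_distrib mult.assoc[symmetric] jj)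
      finally show ?thesis .
    qed
    have "F (scaleK c y) = c * F y" for c y
    proof -
      have c: "c = of_real (Re (h c)) + j * of_real (Im (h c))"
        by (rule h_inj) (simp add: h(1,2) h_real j complex_eq[symmetric])
      have "F (scaleK (of_real a + j * of_real b) y) = (of_real a + j * of_real b) * F y" for a b
      proof -
        have "F (scaleK (of_real a + j * of_real b) y) =
            F (scaleK (of_real a) y) + F (scaleK j (scaleK (of_real b) y))"
          by (simp add: scale_left_distrib Fadd scale_scale)
        also have "\<dots> = of_real a * F y + j * (of_real b * F y)"
          by (simp only: Fr Fj)
        finally show ?thesis by (simp add: algebra_simps)
      qed
      then show ?thesis using c by metis
    qed
    moreover have "Re (h (F y)) = f y" for y
      by (simp add: F_def h_diff h(2) h_real j)
    ultimately show ?thesis using Fadd by blast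
  qed
  then obtain F where F: "\<And>y z. F (y + z) = F y + F z" "\<And>c y. F (scaleK c y) = c * F y"
    "\<And>y. Re (h (F y)) = f y" by blast
  have bound: "norm (F y) \<le> norm y" for y
  proof (cases "F y = 0")
    case False
    \<comment> \<open>the scalar of modulus one that rotates \<open>F y\<close> onto the nonnegative real axis\<close>
    define c where "c = of_real (norm (F y)) / F y"
    have nc: "norm c = 1" using False by (simp add: c_def norm_divide)
    have "F (scaleK c y) = of_real (norm (F y))" using False by (simp add: F(2) c_def)
    then have "norm (F y) = f (scaleK c y)" using F(3)[of "scaleK c y"] by (simp add: h_real)
    also have "\<dots> \<le> norm (scaleK c y)" using f(2)[of "scaleK c y"] by simp
    finally show ?thesis by (simp add: norm_scaleK nc)
  qed simp
  moreover have "norm (F x) = norm x"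
  proof (rule antisym[OF bound])
    have "norm x = Re (h (F x))" using F(3)[of x] f(3) by simp
    also have "\<dots> \<le> norm (h (F x))" by (rule complex_Re_le_cmod)
    finally show "norm x \<le> norm (F x)" by (simp add: h(4))
  qed
  ultimately show ?thesis using that F by blast
qed


section \<open>Duality of finite sums of p-th powers\<close>

text \<open>The unit ball of \<open>\<ell>\<^sub>p\<^sub>*(I)\<close>, without the root in the norm; the exponent \<open>p / (p - 1)\<close> is \<open>p\<^sup>*\<close>.\<close>

definition conj_ball :: "real \<Rightarrow> 'i set \<Rightarrow> ('i \<Rightarrow> 'k::real_normed_field) \<Rightarrow> bool" where
  "conj_ball p I b \<longleftrightarrow> (if p = 1 then \<forall>i\<in>I. norm (b i) \<le> 1
     else (\<Sum>i\<in>I. norm (b i) powr (p / (p - 1))) \<le> 1)"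

lemma Holder_finite:
  fixes a b :: "'i \<Rightarrow> 'k::real_normed_field"
  assumes "finite I" "1 \<le> p" "0 \<le> c"
    and a: "(\<Sum>i\<in>I. norm (a i) powr p) \<le> c powr p" and b: "conj_ball p I b"
  shows "(\<Sum>i\<in>I. norm (b i) * norm (a i)) \<le> c"
proof (cases "c = 0")
  case True
  then have "(\<Sum>i\<in>I. norm (a i) powr p) = 0"
    using a by (intro antisym sum_nonneg) auto
  then have "\<forall>i\<in>I. norm (a i) powr p = 0"
    using assms(1) by (subst (asm) sum_nonneg_eq_0_iff) auto
  then show ?thesis using True by simp
next
  case False
  then have c: "c > 0" using assms by simp
  show ?thesis
  proof (cases "p = 1")
    case True
    have "(\<Sum>i\<in>I. norm (b i) * norm (a i)) \<le> (\<Sum>i\<in>I. norm (a i))"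
      using b True by (intro sum_mono) (simp add: conj_ball_def mult_left_le_one_le)
    then show ?thesis using a True c by simp
  next
    case False
    define q where "q = p / (p - 1)"
    have p: "p > 1" using False assms by simp
    then have q: "q > 1" "1 / p + 1 / q = 1" by (auto simp: q_def field_simps)
    have "(\<Sum>i\<in>I. (norm (a i) / c) * norm (b i))
        \<le> (\<Sum>i\<in>I. (norm (a i) / c) powr p / p + norm (b i) powr q / q)"
      using p q c by (intro sum_mono Youngs_inequality) auto
    also have "\<dots> = (\<Sum>i\<in>I. norm (a i) powr p) / c powr p / p + (\<Sum>i\<in>I. norm (b i) powr q) / q"
      using c by (simp add: sum.distrib sum_divide_distrib powr_divide)
    also have "\<dots> \<le> 1 / p + 1 / q"
      using a b False c p q unfolding conj_ball_def
      by (intro add_mono divide_right_mono) (auto simp: q_def)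
    finally have "(\<Sum>i\<in>I. norm (b i) * norm (a i)) / c \<le> 1"
      by (simp add: q(2) sum_divide_distrib mult.commute)
    then show ?thesis using c by (simp add: field_simps)
  qed
qed

text \<open>The extremal element is \<open>b\<^sub>i = |a\<^sub>i|\<^sup>p\<^sup>-\<^sup>1 |a\<^sub>i| / (a\<^sub>i K)\<close>, where \<open>K\<close> is the \<open>\<ell>\<^sub>p\<^sub>*\<close>-norm of
  \<open>|a|\<^sup>p\<^sup>-\<^sup>1\<close>. The formula also covers \<open>p = 1\<close>, where it reduces to signs.\<close>

lemma Holder_converse_finite:
  fixes a :: "'i \<Rightarrow> 'k::real_normed_field"
  assumes "finite I" "1 \<le> p" "0 \<le> c"
    and le: "\<And>b. conj_ball p I b \<Longrightarrow> norm (\<Sum>i\<in>I. b i * a i) \<le> c"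
  shows "(\<Sum>i\<in>I. norm (a i) powr p) \<le> c powr p"
proof (cases "(\<Sum>i\<in>I. norm (a i) powr p) = 0")
  case False
  define S where "S = (\<Sum>i\<in>I. norm (a i) powr p)"
  have S: "S > 0" using False sum_nonneg[of I "\<lambda>i. norm (a i) powr p"] by (simp add: S_def)
  \<comment> \<open>the exponent is \<open>1 / p\<^sup>*\<close>\<close>
  define K where "K = S powr ((p - 1) / p)"
  have K: "K > 0" using S by (simp add: K_def)
  define b :: "'i \<Rightarrow> 'k"
    where "b i = of_real (norm (a i) powr (p - 1) / K) * (of_real (norm (a i)) / a i)" for i
  have nb: "norm (b i) = (if a i = 0 then 0 else norm (a i) powr (p - 1) / K)" for i
    using K by (simp add: b_def norm_mult norm_divide)
  have "conj_ball p I b"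
  proof (cases "p = 1")
    case True
    then show ?thesis using S by (auto simp: conj_ball_def nb K_def)
  next
    case False
    then have p: "p > 1" using assms by simp
    have "norm (b i) powr (p / (p - 1)) = norm (a i) powr p / S" for i
      using p S K by (auto simp: nb powr_divide powr_powr K_def)
    then show ?thesis using False S
      by (simp add: conj_ball_def sum_divide_distrib[symmetric] S_def[symmetric])
  qed
  then have "norm (\<Sum>i\<in>I. b i * a i) \<le> c" by (rule le)
  moreover have "b i * a i = of_real (norm (a i) powr p / K)" for i
  proof (cases "a i = 0")
    case False
    then have "norm (a i) powr (p - 1) * norm (a i) = norm (a i) powr p"
      by (simp add: powr_mult_base mult.commute)
    moreover have "b i * a i = of_real (norm (a i) powr (p - 1) / K * norm (a i))"
      using False by (simp add: b_def)
    ultimately show ?thesis by simp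
  qed simp
  then have "(\<Sum>i\<in>I. b i * a i) = of_real (S / K)"
    by (simp add: S_def sum_divide_distrib)
  moreover have "S / K = S powr (1 / p)"
  proof -
    have "S / K = S powr (1 - (p - 1) / p)" using S by (simp add: K_def powr_diff)
    also have "1 - (p - 1) / p = 1 / p" using assms by (simp add: field_simps)
    finally show ?thesis .
  qed
  ultimately have "S powr (1 / p) \<le> c" by simp
  then have "(S powr (1 / p)) powr p \<le> c powr p" using assms by (intro powr_mono2) auto
  then show ?thesis using S assms by (simp add: powr_powr S_def)
qed (simp)


section \<open>Norms of scalar sequences and double sequences\<close>

lemma ennreal_powr_le_iff:
  assumes "r > 0" "c \<ge> 0"
  shows "ennreal_powr a (1 / r) \<le> ennreal c \<longleftrightarrow> a \<le> ennreal (c powr r)"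
proof (cases a)
  case (real t)
  have "t powr (1 / r) \<le> c \<longleftrightarrow> t \<le> c powr r"
  proof
    assume "t powr (1 / r) \<le> c"
    then have "(t powr (1 / r)) powr r \<le> c powr r" using assms by (intro powr_mono2) auto
    then show "t \<le> c powr r" using assms real by (simp add: powr_powr)
  next
    assume "t \<le> c powr r"
    then have "t powr (1 / r) \<le> (c powr r) powr (1 / r)" using assms real by (intro powr_mono2) auto
    then show "t powr (1 / r) \<le> c" using assms real by (simp add: powr_powr)
  qed
  then show ?thesis using real assms by (simp add: ennreal_powr_def)
next
  case top
  then show ?thesis by (simp add: ennreal_powr_def top_unique)
qed

lemma suminf_ennreal_le_iff:
  assumes "\<And>j. f j \<ge> 0" "C \<ge> 0"
  shows "suminf (\<lambda>j. ennreal (f j)) \<le> ennreal C \<longleftrightarrow> (\<forall>N. sum f {..<N} \<le> C)"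
proof -
  have "suminf (\<lambda>j. ennreal (f j)) \<le> ennreal C \<longleftrightarrow> (\<forall>N. (\<Sum>j<N. ennreal (f j)) \<le> ennreal C)"
    by (auto intro: suminf_le_const order_trans[OF sum_le_suminf])
  also have "\<dots> \<longleftrightarrow> (\<forall>N. sum f {..<N} \<le> C)"
    using assms by (simp add: sum_ennreal sum_nonneg)
  finally show ?thesis .
qed

text \<open>Bounds on norms are used in this finitary form throughout: sums over rectangles can be
  exchanged, compared and passed to the limit without any convergence argument.\<close>

lemma suminf2_ennreal_le_iff:
  assumes "\<And>n j. f n j \<ge> 0" "C \<ge> 0"
  shows "suminf (\<lambda>n. suminf (\<lambda>j. ennreal (f n j))) \<le> ennreal C \<longleftrightarrow>
    (\<forall>N M. (\<Sum>n<N. \<Sum>j<M. f n j) \<le> C)"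
proof -
  have "(\<Sum>n<N. suminf (\<lambda>j. ennreal (f n j))) = suminf (\<lambda>j. ennreal (\<Sum>n<N. f n j))" for N
    using assms by (simp add: suminf_sum[symmetric] sum_ennreal)
  then have "(\<Sum>n<N. suminf (\<lambda>j. ennreal (f n j))) \<le> ennreal C \<longleftrightarrow>
      (\<forall>M. (\<Sum>n<N. \<Sum>j<M. f n j) \<le> C)" for N
    using assms by (simp add: suminf_ennreal_le_iff sum_nonneg) (simp add: sum.swap[of _ "{..<N}"])
  moreover have "suminf (\<lambda>n. suminf (\<lambda>j. ennreal (f n j))) \<le> ennreal C \<longleftrightarrow>
      (\<forall>N. (\<Sum>n<N. suminf (\<lambda>j. ennreal (f n j))) \<le> ennreal C)"
    by (auto intro: suminf_le_const order_trans[OF sum_le_suminf])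
  ultimately show ?thesis by blast
qed

lemma lp_norm_le_iff:
  assumes "r > 0" "c \<ge> 0"
  shows "lp_norm (ennreal r) a \<le> ennreal c \<longleftrightarrow> (\<forall>N. (\<Sum>j<N. \<bar>a j\<bar> powr r) \<le> c powr r)"
  using assms by (simp add: lp_norm_def ennreal_powr_le_iff suminf_ennreal_le_iff)

lemma lp_norm_top_le_iff:
  assumes "c \<ge> 0"
  shows "lp_norm top a \<le> ennreal c \<longleftrightarrow> (\<forall>j. \<bar>a j\<bar> \<le> c)"
  using assms by (simp add: lp_norm_def SUP_le_iff)

lemma enn2real_le_1_iff: "a < \<infinity> \<and> enn2real a \<le> 1 \<longleftrightarrow> a \<le> 1"
  by (cases a) (auto simp: top_unique)

lemma mem_unit_ball_ell:
  "x \<in> unit_ball (ell q V) \<longleftrightarrow> range x \<subseteq> carrier V \<and> ell_norm q V x \<le> ennreal 1"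
  using enn2real_le_1_iff[of "ell_norm q V x"] by (auto simp: unit_ball_def ell_def seq_space_def)

lemma mem_unit_ball_ell_weak:
  "x \<in> unit_ball (ell_weak p V) \<longleftrightarrow> range x \<subseteq> carrier V \<and> weak_norm p V x \<le> ennreal 1"
  using enn2real_le_1_iff[of "weak_norm p V x"]
  by (auto simp: unit_ball_def ell_weak_def seq_space_def)

lemma ell_finite_normD:
  assumes "x \<in> carrier (ell q V)"
  shows "lp_norm q (\<lambda>j. vnorm V (x j)) \<le> ennreal (vnorm (ell q V) x)" "vnorm (ell q V) x \<ge> 0"
  using assms by (auto simp: ell_def seq_space_def ell_norm_def)

lemma ell_norm_leI:
  assumes "range x \<subseteq> carrier V" "lp_norm q (\<lambda>j. vnorm V (x j)) \<le> ennreal c" "c \<ge> 0"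
  shows "x \<in> carrier (ell q V)" "vnorm (ell q V) x \<le> c"
  using assms order.strict_trans1[OF assms(2) ennreal_less_top]
  by (auto simp: ell_def seq_space_def ell_norm_def enn2real_leI)

lemma scalars_simps [simp]:
  "carrier scalars = UNIV" "vadd scalars = (+)" "vscale scalars = (*)" "vnorm scalars = norm"
  by (auto simp: nspace_of_def)

text \<open>The unit ball of \<open>\<ell>\<^sub>p\<^sub>*(\<ell>\<^sub>p\<^sub>*)\<close>. Restricted to a finite rectangle of indices it becomes the unit
  ball of \<open>\<ell>\<^sub>p\<^sub>*\<close> over the rectangle (\<open>conj_ball_of_double_ball\<close>, \<open>double_ball_of_conj_ball\<close>).\<close>

abbreviation double_ball :: "real \<Rightarrow> (nat \<Rightarrow> nat \<Rightarrow> 'k::real_or_complex) set" where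
  "double_ball p \<equiv> unit_ball (ell (conj_exp p) (ell (conj_exp p) scalars))"

lemma conj_ball_of_double_ball:
  fixes \<psi> :: "nat \<Rightarrow> nat \<Rightarrow> 'k::real_or_complex"
  assumes "1 \<le> p" and \<psi>: "\<psi> \<in> double_ball p"
  shows "conj_ball p ({..<N} \<times> {..<M}) (\<lambda>(n, j). \<psi> n j)"
proof -
  define s where "s n = vnorm (ell (conj_exp p) scalars) (\<psi> n)" for n
  have mem: "\<psi> n \<in> carrier (ell (conj_exp p) scalars)" for n
    using \<psi> by (auto simp: mem_unit_ball_ell)
  have inner: "lp_norm (conj_exp p) (\<lambda>j. norm (\<psi> n j)) \<le> ennreal (s n)" and s0: "s n \<ge> 0" for n
    using ell_finite_normD[OF mem] by (simp_all add: s_def)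
  have outer: "lp_norm (conj_exp p) s \<le> ennreal 1"
    using \<psi> by (simp add: mem_unit_ball_ell ell_norm_def s_def[abs_def])
  show ?thesis
  proof (cases "p = 1")
    case True
    then have "norm (\<psi> n j) \<le> s n" "s n \<le> 1" for n j
      using inner[of n] outer s0 by (auto simp: conj_exp_def lp_norm_top_le_iff simp del: ennreal_1)
    then have "norm (\<psi> n j) \<le> 1" for n j by (rule order_trans)
    then show ?thesis using True by (auto simp: conj_ball_def)
  next
    case False
    define r where "r = p / (p - 1)"
    have r: "r > 0" "conj_exp p = ennreal r" using False assms by (auto simp: r_def conj_exp_def)
    have "(\<Sum>n<N. \<Sum>j<M. norm (\<psi> n j) powr r) \<le> (\<Sum>n<N. s n powr r)"
      using inner s0 r by (intro sum_mono) (simp add: lp_norm_le_iff)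
    also have "\<dots> \<le> 1"
      using outer s0 r by (simp add: lp_norm_le_iff del: ennreal_1)
    finally show ?thesis using False
      by (simp add: conj_ball_def sum.cartesian_product split_def r_def)
  qed
qed

lemma conj_ball_row:
  fixes \<psi> :: "nat \<Rightarrow> nat \<Rightarrow> 'k::real_or_complex"
  assumes "1 \<le> p" and \<psi>: "\<psi> \<in> double_ball p"
  shows "conj_ball p {..<M} (\<psi> n)"
proof (cases "p = 1")
  case True
  then show ?thesis
    using conj_ball_of_double_ball[OF assms, of "Suc n" M] by (auto simp: conj_ball_def)
next
  case False
  let ?r = "p / (p - 1)"
  have "(\<Sum>j<M. norm (\<psi> n j) powr ?r) \<le> (\<Sum>k<Suc n. \<Sum>j<M. norm (\<psi> k j) powr ?r)"
    by (rule member_le_sum) (auto intro: sum_nonneg)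
  also have "\<dots> \<le> 1"
    using conj_ball_of_double_ball[OF assms, of "Suc n" M] False
    by (simp only: conj_ball_def if_False sum.cartesian_product split_def)
  finally show ?thesis using False by (simp add: conj_ball_def)
qed

lemma double_ball_of_conj_ball:
  fixes b :: "nat \<times> nat \<Rightarrow> 'k::real_or_complex"
  assumes "1 \<le> p" and b: "conj_ball p ({..<N} \<times> {..<M}) b"
  shows "(\<lambda>n j. if n < N \<and> j < M then b (n, j) else 0) \<in> double_ball p"
proof -
  define \<psi> where "\<psi> n j = (if n < N \<and> j < M then b (n, j) else 0)" for n j
  show ?thesis
  proof (cases "p = 1")
    case True
    have n1: "norm (\<psi> n j) \<le> 1" for n j using b True by (auto simp: \<psi>_def conj_ball_def)
    then have "lp_norm (conj_exp p) (\<lambda>j. norm (\<psi> n j)) \<le> ennreal 1" for n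
      using True by (simp add: conj_exp_def lp_norm_top_le_iff del: ennreal_1)
    then have *: "\<psi> n \<in> carrier (ell (conj_exp p) scalars)"
        "vnorm (ell (conj_exp p) scalars) (\<psi> n) \<le> 1" for n
      using ell_norm_leI[of "\<psi> n" scalars "conj_exp p" 1] by auto
    then have "lp_norm (conj_exp p) (\<lambda>n. vnorm (ell (conj_exp p) scalars) (\<psi> n)) \<le> ennreal 1"
      using True ell_finite_normD(2)[OF *(1)]
      by (simp add: conj_exp_def lp_norm_top_le_iff del: ennreal_1)
    then show ?thesis using *(1)
      by (auto simp: mem_unit_ball_ell ell_norm_def \<psi>_def[abs_def])
  next
    case False
    define r where "r = p / (p - 1)"
    have r: "r > 0" "conj_exp p = ennreal r" using False assms by (auto simp: r_def conj_exp_def)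
    define t where "t n = (\<Sum>j<M. norm (\<psi> n j) powr r)" for n
    have t0: "t n \<ge> 0" for n unfolding t_def by (intro sum_nonneg) auto
    have "(\<Sum>j<K. norm (\<psi> n j) powr r) \<le> t n" for n K
    proof -
      have "(\<Sum>j<K. norm (\<psi> n j) powr r) = (\<Sum>j\<in>{..<K} \<inter> {..<M}. norm (\<psi> n j) powr r)"
        by (rule sum.mono_neutral_right) (auto simp: \<psi>_def)
      also have "\<dots> \<le> t n" unfolding t_def by (rule sum_mono2) auto
      finally show ?thesis .
    qed
    then have "lp_norm (conj_exp p) (\<lambda>j. norm (\<psi> n j)) \<le> ennreal (t n powr (1 / r))" for n
      using r t0 by (simp add: lp_norm_le_iff powr_powr)
    then have *: "\<psi> n \<in> carrier (ell (conj_exp p) scalars)"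
        "vnorm (ell (conj_exp p) scalars) (\<psi> n) \<le> t n powr (1 / r)" for n
      using ell_norm_leI[of "\<psi> n" scalars "conj_exp p" "t n powr (1 / r)"] by auto
    have "(\<Sum>n<K. vnorm (ell (conj_exp p) scalars) (\<psi> n) powr r) \<le> 1" for K
    proof -
      have "vnorm (ell (conj_exp p) scalars) (\<psi> n) powr r \<le> t n" for n
        using powr_mono2[OF _ _ *(2)[of n], of r] ell_finite_normD(2)[OF *(1)] r t0
        by (simp add: powr_powr)
      then have "(\<Sum>n<K. vnorm (ell (conj_exp p) scalars) (\<psi> n) powr r) \<le> (\<Sum>n<K. t n)"
        by (rule sum_mono)
      also have "\<dots> = (\<Sum>n\<in>{..<K} \<inter> {..<N}. t n)"
        by (rule sum.mono_neutral_right) (auto simp: t_def \<psi>_def)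
      also have "\<dots> \<le> (\<Sum>n<N. t n)" by (rule sum_mono2) (auto simp: t0)
      also have "\<dots> = (\<Sum>i\<in>{..<N} \<times> {..<M}. norm (b i) powr r)"
        unfolding t_def sum.cartesian_product by (rule sum.cong) (auto simp: \<psi>_def)
      also have "\<dots> \<le> 1" using b False by (simp add: conj_ball_def r_def)
      finally show ?thesis .
    qed
    then have "lp_norm (conj_exp p) (\<lambda>n. vnorm (ell (conj_exp p) scalars) (\<psi> n)) \<le> ennreal 1"
      using r ell_finite_normD(2)[OF *(1)] by (simp add: lp_norm_le_iff del: ennreal_1)
    then show ?thesis using *(1)
      by (auto simp: mem_unit_ball_ell ell_norm_def \<psi>_def[abs_def])
  qed
qed

text \<open>Duality of \<open>\<ell>\<^sub>p\<close> and \<open>\<ell>\<^sub>p\<^sub>*\<close> over a rectangle: members of \<open>double_ball\<close> are restricted to the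
  rectangle for one direction, and members of \<open>conj_ball\<close> are extended by zero for the other.\<close>

lemma lp_sum_le_iff_dual:
  fixes a :: "nat \<Rightarrow> nat \<Rightarrow> 'k::real_or_complex"
  assumes "1 \<le> p" "0 \<le> c"
  shows "(\<Sum>n<N. \<Sum>j<M. norm (a n j) powr p) \<le> c powr p \<longleftrightarrow>
    (\<forall>\<psi>\<in>double_ball p. norm (\<Sum>n<N. \<Sum>j<M. \<psi> n j * a n j) \<le> c)"
    (is "?L \<longleftrightarrow> ?R")
proof
  assume L: ?L
  show ?R
  proof
    fix \<psi> :: "nat \<Rightarrow> nat \<Rightarrow> 'k" assume "\<psi> \<in> double_ball p"
    then have "conj_ball p ({..<N} \<times> {..<M}) (\<lambda>(n, j). \<psi> n j)"
      using assms by (intro conj_ball_of_double_ball)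
    then have "(\<Sum>i\<in>{..<N} \<times> {..<M}. norm (case i of (n, j) \<Rightarrow> \<psi> n j) * norm (case i of (n, j) \<Rightarrow> a n j)) \<le> c"
      using assms L by (intro Holder_finite[of _ p])
        (auto simp: sum.cartesian_product split_def)
    moreover have "norm (\<Sum>n<N. \<Sum>j<M. \<psi> n j * a n j) \<le>
        (\<Sum>i\<in>{..<N} \<times> {..<M}. norm (case i of (n, j) \<Rightarrow> \<psi> n j) * norm (case i of (n, j) \<Rightarrow> a n j))"
      unfolding sum.cartesian_product
      by (rule order_trans[OF norm_sum]) (simp add: split_def norm_mult)
    ultimately show "norm (\<Sum>n<N. \<Sum>j<M. \<psi> n j * a n j) \<le> c" by simp
  qed
next
  assume R: ?R
  have "(\<Sum>i\<in>{..<N} \<times> {..<M}. norm (case i of (n, j) \<Rightarrow> a n j) powr p) \<le> c powr p"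
  proof (rule Holder_converse_finite)
    fix b :: "nat \<times> nat \<Rightarrow> 'k" assume "conj_ball p ({..<N} \<times> {..<M}) b"
    then have "norm (\<Sum>n<N. \<Sum>j<M. (if n < N \<and> j < M then b (n, j) else 0) * a n j) \<le> c"
      by (rule bspec[OF R double_ball_of_conj_ball[OF assms(1)]])
    moreover have "(\<Sum>n<N. \<Sum>j<M. (if n < N \<and> j < M then b (n, j) else 0) * a n j) =
        (\<Sum>i\<in>{..<N} \<times> {..<M}. b i * (case i of (n, j) \<Rightarrow> a n j))"
      unfolding sum.cartesian_product by (rule sum.cong) auto
    ultimately show "norm (\<Sum>i\<in>{..<N} \<times> {..<M}. b i * (case i of (n, j) \<Rightarrow> a n j)) \<le> c"
      by simp
  qed (use assms in auto)
  then show ?L by (simp add: sum.cartesian_product split_def)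
qed

lemma Lp_mem_iff:
  fixes y :: "nat \<Rightarrow> 'k::real_or_complex"
  assumes "1 \<le> p"
  shows "y \<in> carrier (ell (ennreal p) scalars) \<longleftrightarrow> summable (\<lambda>j. norm (y j) powr p)"
proof
  assume "y \<in> carrier (ell (ennreal p) scalars)"
  then have "(\<Sum>j<N. norm (y j) powr p) \<le> vnorm (ell (ennreal p) scalars) y powr p" for N
    using ell_finite_normD[of y "ennreal p" scalars] assms by (simp add: lp_norm_le_iff)
  then show "summable (\<lambda>j. norm (y j) powr p)"
    by (intro summableI_nonneg_bounded) auto
next
  let ?S = "suminf (\<lambda>j. norm (y j) powr p)"
  assume s: "summable (\<lambda>j. norm (y j) powr p)"
  then have "(\<Sum>j<N. norm (y j) powr p) \<le> (?S powr (1 / p)) powr p" for N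
    using assms by (simp add: powr_powr suminf_nonneg sum_le_suminf)
  then show "y \<in> carrier (ell (ennreal p) scalars)"
    using assms by (intro ell_norm_leI(1)[where c = "?S powr (1 / p)"]) (auto simp: lp_norm_le_iff)
qed

lemma Lp_mem_bound:
  fixes y :: "nat \<Rightarrow> 'k::real_or_complex"
  assumes "1 \<le> p" "y \<in> carrier (ell (ennreal p) scalars)"
  obtains C where "C \<ge> 0" "\<And>M. (\<Sum>j<M. norm (y j) powr p) \<le> C powr p"
  using that[of "vnorm (ell (ennreal p) scalars) y"] ell_finite_normD[of y "ennreal p" scalars] assms
  by (simp add: lp_norm_le_iff)

lemma summable_pairing:
  fixes y :: "nat \<Rightarrow> 'k::real_or_complex"
  assumes p: "1 \<le> p" and y: "y \<in> carrier (ell (ennreal p) scalars)" and \<psi>: "\<psi> \<in> double_ball p"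
  shows "summable (\<lambda>j. norm (\<psi> n j * y j))"
proof -
  obtain C where C: "C \<ge> 0" "\<And>M. (\<Sum>j<M. norm (y j) powr p) \<le> C powr p"
    using Lp_mem_bound[OF p y] by blast
  have "(\<Sum>j<M. norm (\<psi> n j * y j)) \<le> C" for M
    using Holder_finite[OF _ p C(1,2) conj_ball_row[OF p \<psi>]] by (simp add: norm_mult)
  then show ?thesis by (intro summableI_nonneg_bounded) auto
qed


section \<open>Completions of normed spaces\<close>

text \<open>The axioms of a normed space relative to a carrier. The record has no zero vector; its role
  is played by \<open>vscale X 0 y\<close>, and \<open>add_zero\<close> makes this vector neutral for every \<open>y\<close>.\<close>

locale normed_nspace =
  fixes X :: "('k::real_normed_field, 'a) nspace"
  assumes add_closed: "\<And>x y. x \<in> carrier X \<Longrightarrow> y \<in> carrier X \<Longrightarrow> vadd X x y \<in> carrier X"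
    and scale_closed: "\<And>c x. x \<in> carrier X \<Longrightarrow> vscale X c x \<in> carrier X"
    and add_assoc: "\<And>x y z. x \<in> carrier X \<Longrightarrow> y \<in> carrier X \<Longrightarrow> z \<in> carrier X \<Longrightarrow>
      vadd X (vadd X x y) z = vadd X x (vadd X y z)"
    and add_commute: "\<And>x y. x \<in> carrier X \<Longrightarrow> y \<in> carrier X \<Longrightarrow> vadd X x y = vadd X y x"
    and add_zero: "\<And>x y. x \<in> carrier X \<Longrightarrow> y \<in> carrier X \<Longrightarrow> vadd X x (vscale X 0 y) = x"
    and scale_add_right: "\<And>c x y. x \<in> carrier X \<Longrightarrow> y \<in> carrier X \<Longrightarrow>
      vscale X c (vadd X x y) = vadd X (vscale X c x) (vscale X c y)"
    and scale_add_left: "\<And>a b x. x \<in> carrier X \<Longrightarrow>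
      vscale X (a + b) x = vadd X (vscale X a x) (vscale X b x)"
    and scale_scale: "\<And>a b x. x \<in> carrier X \<Longrightarrow> vscale X a (vscale X b x) = vscale X (a * b) x"
    and scale_one: "\<And>x. x \<in> carrier X \<Longrightarrow> vscale X 1 x = x"
    and norm_scale: "\<And>c x. x \<in> carrier X \<Longrightarrow> vnorm X (vscale X c x) = norm c * vnorm X x"
    and norm_triangle: "\<And>x y. x \<in> carrier X \<Longrightarrow> y \<in> carrier X \<Longrightarrow>
      vnorm X (vadd X x y) \<le> vnorm X x + vnorm X y"
    and norm_eq_zero: "\<And>x. x \<in> carrier X \<Longrightarrow> vnorm X x = 0 \<Longrightarrow> x = vscale X 0 x"
begin

abbreviation diff :: "'a \<Rightarrow> 'a \<Rightarrow> 'a" where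
  "diff x y \<equiv> vadd X x (vscale X (- 1) y)"

lemma diff_closed: "x \<in> carrier X \<Longrightarrow> y \<in> carrier X \<Longrightarrow> diff x y \<in> carrier X"
  by (simp add: add_closed scale_closed)

lemma add_left_commute:
  "x \<in> carrier X \<Longrightarrow> y \<in> carrier X \<Longrightarrow> z \<in> carrier X \<Longrightarrow>
    vadd X x (vadd X y z) = vadd X y (vadd X x z)"
  by (metis add_assoc add_commute)

lemma neg_add_self: "y \<in> carrier X \<Longrightarrow> vadd X (vscale X (- 1) y) y = vscale X 0 y"
  using scale_add_left[of y "- 1" 1] by (simp add: scale_one)

lemma diff_add_cancel: "x \<in> carrier X \<Longrightarrow> y \<in> carrier X \<Longrightarrow> vadd X (diff x y) y = x"
  by (simp add: add_assoc scale_closed neg_add_self add_zero)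

lemma diff_add_diff:
  assumes "x \<in> carrier X" "y \<in> carrier X" "z \<in> carrier X"
  shows "vadd X (diff x y) (diff y z) = diff x z"
  using assms add_assoc[of "diff x y" y "vscale X (- 1) z"]
  by (simp add: diff_add_cancel diff_closed scale_closed)

lemma diff_add:
  assumes "x \<in> carrier X" "y \<in> carrier X" "x' \<in> carrier X" "y' \<in> carrier X"
  shows "diff (vadd X x x') (vadd X y y') = vadd X (diff x y) (diff x' y')"
  using assms by (simp add: scale_add_right add_assoc scale_closed add_closed add_left_commute)

lemma diff_scale:
  assumes "x \<in> carrier X" "y \<in> carrier X"
  shows "diff (vscale X c x) (vscale X c y) = vscale X c (diff x y)"
  using assms by (simp add: scale_add_right scale_scale scale_closed)

lemma norm_zero: "x \<in> carrier X \<Longrightarrow> vnorm X (vscale X 0 x) = 0"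
  by (simp add: norm_scale)

lemma norm_nonneg: "x \<in> carrier X \<Longrightarrow> vnorm X x \<ge> 0"
  using norm_triangle[of "vscale X (- 1) x" x] norm_scale[of x "- 1"]
  by (simp add: neg_add_self norm_zero scale_closed)

lemma vdist_nonneg: "x \<in> carrier X \<Longrightarrow> y \<in> carrier X \<Longrightarrow> vdist X x y \<ge> 0"
  unfolding vdist_def by (intro norm_nonneg diff_closed)

lemma vdist_triangle:
  "x \<in> carrier X \<Longrightarrow> y \<in> carrier X \<Longrightarrow> z \<in> carrier X \<Longrightarrow> vdist X x z \<le> vdist X x y + vdist X y z"
  unfolding vdist_def by (metis diff_add_diff diff_closed norm_triangle)

lemma vdist_commute: "x \<in> carrier X \<Longrightarrow> y \<in> carrier X \<Longrightarrow> vdist X x y = vdist X y x"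
proof -
  assume x: "x \<in> carrier X" and y: "y \<in> carrier X"
  have "vscale X (- 1) (diff x y) = diff y x"
    using x y by (simp add: scale_add_right scale_scale scale_closed scale_one add_commute)
  then show ?thesis
    using norm_scale[OF diff_closed[OF x y], of "- 1"] by (simp add: vdist_def)
qed

lemma vdist_eq_0:
  assumes "x \<in> carrier X" "y \<in> carrier X" "vdist X x y = 0"
  shows "x = y"
proof -
  have "diff x y = vscale X 0 (diff x y)"
    using assms by (intro norm_eq_zero diff_closed) (auto simp: vdist_def)
  then have "x = vadd X (vscale X 0 (diff x y)) y"
    using diff_add_cancel[of x y] assms by simp
  also have "\<dots> = y"
    using assms by (simp add: add_commute[of _ y] scale_closed diff_closed add_zero)
  finally show ?thesis .
qed

lemma vdist_add:
  "x \<in> carrier X \<Longrightarrow> y \<in> carrier X \<Longrightarrow> x' \<in> carrier X \<Longrightarrow> y' \<in> carrier X \<Longrightarrow>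
    vdist X (vadd X x x') (vadd X y y') \<le> vdist X x y + vdist X x' y'"
  unfolding vdist_def by (simp add: diff_add norm_triangle diff_closed)

lemma vdist_scale:
  "x \<in> carrier X \<Longrightarrow> y \<in> carrier X \<Longrightarrow> vdist X (vscale X c x) (vscale X c y) = norm c * vdist X x y"
  unfolding vdist_def by (simp add: diff_scale norm_scale diff_closed)

lemma norm_diff_le_vdist:
  assumes "x \<in> carrier X" "y \<in> carrier X"
  shows "\<bar>vnorm X x - vnorm X y\<bar> \<le> vdist X x y"
proof -
  have le: "vnorm X x \<le> vdist X x y + vnorm X y" if "x \<in> carrier X" "y \<in> carrier X" for x y
    using norm_triangle[of "diff x y" y] that by (simp add: diff_add_cancel diff_closed vdist_def)
  from le[of x y] le[of y x] assms vdist_commute[of x y] show ?thesis by simp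
qed

text \<open>A point \<open>x\<close> corresponds to the set \<open>T x\<close> of all sequences in \<open>W\<close> whose images converge to \<open>x\<close>.
  This set is nonempty by density and is a full class of Cauchy sequences modulo null
  sequences, because \<open>j\<close> preserves distances; completeness of \<open>X\<close> says that every class arises.\<close>

theorem isometric_completion:
  assumes complete: "\<And>s. s \<in> cauchy_seqs X \<Longrightarrow> \<exists>x\<in>carrier X. (\<lambda>n. vdist X (s n) x) \<longlonglongrightarrow> 0"
    and W_add: "\<And>u v. u \<in> carrier W \<Longrightarrow> v \<in> carrier W \<Longrightarrow> vadd W u v \<in> carrier W"
    and W_scale: "\<And>c u. u \<in> carrier W \<Longrightarrow> vscale W c u \<in> carrier W"
    and j_closed: "\<And>u. u \<in> carrier W \<Longrightarrow> j u \<in> carrier X"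
    and j_add: "\<And>u v. u \<in> carrier W \<Longrightarrow> v \<in> carrier W \<Longrightarrow> j (vadd W u v) = vadd X (j u) (j v)"
    and j_scale: "\<And>c u. u \<in> carrier W \<Longrightarrow> j (vscale W c u) = vscale X c (j u)"
    and j_norm: "\<And>u. u \<in> carrier W \<Longrightarrow> vnorm W u = vnorm X (j u)"
    and dense: "\<And>x. x \<in> carrier X \<Longrightarrow>
      \<exists>s. range s \<subseteq> carrier W \<and> (\<lambda>n. vdist X (j (s n)) x) \<longlonglongrightarrow> 0"
  shows "isometrically_isomorphic X (completion_of W)"
proof -
  have null: "f \<longlonglongrightarrow> 0" if "\<And>n. 0 \<le> f n" "\<And>n. f n \<le> g n" "g \<longlonglongrightarrow> 0" for f g :: "nat \<Rightarrow> real"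
    by (rule tendsto_sandwich[OF _ _ tendsto_const that(3)]) (use that in auto)
  have dW: "vdist W u v = vdist X (j u) (j v)" if "u \<in> carrier W" "v \<in> carrier W" for u v
    using that by (simp add: vdist_def j_norm j_add j_scale W_add W_scale)
  define T where "T x = {s. range s \<subseteq> carrier W \<and> (\<lambda>n. vdist X (j (s n)) x) \<longlonglongrightarrow> 0}" for x
  have TD: "s n \<in> carrier W" "j (s n) \<in> carrier X" "(\<lambda>n. vdist X (j (s n)) x) \<longlonglongrightarrow> 0"
    if "s \<in> T x" for s x n
    using that j_closed by (auto simp: T_def)
  have T_cauchy: "s \<in> cauchy_seqs W" if "x \<in> carrier X" "s \<in> T x" for x s
  proof -
    have "\<exists>N. \<forall>m\<ge>N. \<forall>n\<ge>N. vdist W (s m) (s n) < e" if e: "e > 0" for e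
    proof -
      obtain N where N: "\<And>n. n \<ge> N \<Longrightarrow> \<bar>vdist X (j (s n)) x\<bar> < e / 2"
        using LIMSEQ_D[OF TD(3)[OF \<open>s \<in> T x\<close>], of "e / 2"] e by auto
      have "vdist W (s m) (s n) < e" if "m \<ge> N" "n \<ge> N" for m n
      proof -
        have "vdist X (j (s m)) (j (s n)) \<le> vdist X (j (s m)) x + vdist X x (j (s n))"
          using TD[OF \<open>s \<in> T x\<close>] \<open>x \<in> carrier X\<close> by (intro vdist_triangle)
        then show ?thesis
          using N[OF that(1)] N[OF that(2)] TD[OF \<open>s \<in> T x\<close>] \<open>x \<in> carrier X\<close>
          by (simp add: dW vdist_commute[of x])
      qed
      then show ?thesis by blast
    qed
    then show ?thesis using TD(1)[OF \<open>s \<in> T x\<close>] by (auto simp: cauchy_seqs_def)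
  qed
  have T_class: "cauchy_class W s = T x" if x: "x \<in> carrier X" and s: "s \<in> T x" for x s
  proof
    show "T x \<subseteq> cauchy_class W s"
    proof
      fix t assume t: "t \<in> T x"
      have "(\<lambda>n. vdist W (s n) (t n)) \<longlonglongrightarrow> 0"
      proof (rule null)
        show "(\<lambda>n. vdist X (j (s n)) x + vdist X (j (t n)) x) \<longlonglongrightarrow> 0"
          using tendsto_add[OF TD(3)[OF s] TD(3)[OF t]] by simp
        show "0 \<le> vdist W (s n) (t n)" for n
          using TD[OF s] TD[OF t] by (simp add: dW vdist_nonneg)
        show "vdist W (s n) (t n) \<le> vdist X (j (s n)) x + vdist X (j (t n)) x" for n
          using TD[OF s] TD[OF t] x vdist_triangle[of "j (s n)" x "j (t n)"]
          by (simp add: dW vdist_commute[of x])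
      qed
      then show "t \<in> cauchy_class W s"
        using T_cauchy[OF x t] by (simp add: cauchy_class_def)
    qed
    show "cauchy_class W s \<subseteq> T x"
    proof
      fix t assume "t \<in> cauchy_class W s"
      then have t: "\<And>n. t n \<in> carrier W" and lim: "(\<lambda>n. vdist W (s n) (t n)) \<longlonglongrightarrow> 0"
        by (auto simp: cauchy_class_def cauchy_seqs_def)
      have "(\<lambda>n. vdist X (j (t n)) x) \<longlonglongrightarrow> 0"
      proof (rule null)
        show "(\<lambda>n. vdist W (s n) (t n) + vdist X (j (s n)) x) \<longlonglongrightarrow> 0"
          using tendsto_add[OF lim TD(3)[OF s]] by simp
        show "0 \<le> vdist X (j (t n)) x" for n
          by (intro vdist_nonneg j_closed t x)
        show "vdist X (j (t n)) x \<le> vdist W (s n) (t n) + vdist X (j (s n)) x" for n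
          using TD[OF s] t j_closed x vdist_triangle[of "j (t n)" "j (s n)" x]
          by (simp add: dW vdist_commute[of "j (t n)"])
      qed
      then show "t \<in> T x" using t by (auto simp: T_def)
    qed
  qed
  have T_ex: "\<exists>s. s \<in> T x" if "x \<in> carrier X" for x
    using dense[OF that] by (simp add: T_def)
  have T_onto: "\<exists>x\<in>carrier X. s \<in> T x" if "s \<in> cauchy_seqs W" for s
  proof -
    have s: "s n \<in> carrier W" for n using that by (auto simp: cauchy_seqs_def)
    have "(\<lambda>n. j (s n)) \<in> cauchy_seqs X"
      using that s j_closed by (auto simp: cauchy_seqs_def dW)
    then show ?thesis using complete[of "\<lambda>n. j (s n)"] s by (auto simp: T_def)
  qed
  have T_inj: "x = y" if x: "x \<in> carrier X" and y: "y \<in> carrier X" and eq: "T x = T y" for x y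
  proof -
    obtain s where s: "s \<in> T x" using T_ex[OF x] by blast
    then have sy: "s \<in> T y" by (simp add: eq)
    have "(\<lambda>n. vdist X x y) \<longlonglongrightarrow> 0"
    proof (rule null)
      show "(\<lambda>n. vdist X (j (s n)) x + vdist X (j (s n)) y) \<longlonglongrightarrow> 0"
        using tendsto_add[OF TD(3)[OF s] TD(3)[OF sy]] by simp
      show "vdist X x y \<le> vdist X (j (s n)) x + vdist X (j (s n)) y" for n
        using TD[OF s] x y vdist_triangle[of x "j (s n)" y] by (simp add: vdist_commute[of x])
    qed (use x y vdist_nonneg in auto)
    then have "vdist X x y = 0" by (simp add: LIMSEQ_const_iff)
    then show ?thesis using vdist_eq_0 x y by blast
  qed
  have "bij_betw T (carrier X) (carrier (completion_of W))"
  proof (rule bij_betwI')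
    fix x y assume "x \<in> carrier X" "y \<in> carrier X"
    then show "(T x = T y) = (x = y)" using T_inj by blast
  next
    fix x assume "x \<in> carrier X"
    then obtain s where "s \<in> T x" using T_ex by blast
    then show "T x \<in> carrier (completion_of W)"
      using T_class[OF \<open>x \<in> carrier X\<close>, of s] T_cauchy[OF \<open>x \<in> carrier X\<close>, of s]
      by (auto simp: completion_of_def)
  next
    fix S assume "S \<in> carrier (completion_of W)"
    then obtain s where s: "s \<in> cauchy_seqs W" "S = cauchy_class W s"
      by (auto simp: completion_of_def)
    then obtain x where "x \<in> carrier X" "s \<in> T x" using T_onto by blast
    then show "\<exists>x\<in>carrier X. S = T x" using T_class s by blast
  qed
  moreover have "T (vadd X x y) = vadd (completion_of W) (T x) (T y)"
    if x: "x \<in> carrier X" and y: "y \<in> carrier X" for x y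
  proof -
    have "(\<lambda>n. vadd W (s n) (t n)) \<in> T (vadd X x y)" if s: "s \<in> T x" and t: "t \<in> T y" for s t
    proof -
      have "(\<lambda>n. vdist X (j (vadd W (s n) (t n))) (vadd X x y)) \<longlonglongrightarrow> 0"
      proof (rule null)
        show "(\<lambda>n. vdist X (j (s n)) x + vdist X (j (t n)) y) \<longlonglongrightarrow> 0"
          using tendsto_add[OF TD(3)[OF s] TD(3)[OF t]] by simp
        show "0 \<le> vdist X (j (vadd W (s n) (t n))) (vadd X x y)" for n
          using TD[OF s] TD[OF t] x y by (intro vdist_nonneg j_closed W_add add_closed)
        show "vdist X (j (vadd W (s n) (t n))) (vadd X x y)
            \<le> vdist X (j (s n)) x + vdist X (j (t n)) y" for n
          using TD[OF s] TD[OF t] x y vdist_add[of "j (s n)" x "j (t n)" y] by (simp add: j_add)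
      qed
      then show ?thesis using TD(1)[OF s] TD(1)[OF t] W_add by (auto simp: T_def)
    qed
    then have "cauchy_class W (\<lambda>n. vadd W (s n) (t n)) = T (vadd X x y)"
      if "s \<in> T x" "t \<in> T y" for s t
      using T_class[OF add_closed[OF x y]] that by blast
    then show ?thesis using T_ex[OF x] T_ex[OF y] by (auto simp: completion_of_def)
  qed
  moreover have "T (vscale X c x) = vscale (completion_of W) c (T x)" if x: "x \<in> carrier X" for c x
  proof -
    have "(\<lambda>n. vscale W c (s n)) \<in> T (vscale X c x)" if s: "s \<in> T x" for s
      using TD[OF s] x tendsto_mult_right_zero[OF TD(3)[OF s], of "norm c"]
      by (auto simp: T_def W_scale j_scale vdist_scale)
    then have "cauchy_class W (\<lambda>n. vscale W c (s n)) = T (vscale X c x)" if "s \<in> T x" for s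
      using T_class[OF scale_closed[OF x]] that by blast
    then show ?thesis using T_ex[OF x] by (auto simp: completion_of_def)
  qed
  moreover have "vnorm (completion_of W) (T x) = vnorm X x" if x: "x \<in> carrier X" for x
  proof -
    define s where "s = (SOME s. s \<in> T x)"
    have s: "s \<in> T x" unfolding s_def using T_ex[OF x] by (rule someI_ex)
    have "(\<lambda>n. vnorm X (j (s n))) \<longlonglongrightarrow> vnorm X x"
    proof (rule LIM_zero_cancel, rule tendsto_rabs_zero_cancel, rule null)
      show "(\<lambda>n. vdist X (j (s n)) x) \<longlonglongrightarrow> 0" by (rule TD(3)[OF s])
    qed (use norm_diff_le_vdist TD(2)[OF s] x in auto)
    then have "lim (\<lambda>n. vnorm W (s n)) = vnorm X x"
      using TD(1)[OF s] by (simp add: j_norm limI)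
    then show ?thesis by (simp add: completion_of_def s_def)
  qed
  ultimately show ?thesis unfolding isometrically_isomorphic_def by blast
qed

end

lemma normed_nspace_subspace:
  assumes "normed_nspace X" and sub: "carrier Y \<subseteq> carrier X"
    and ops: "vadd Y = vadd X" "vscale Y = vscale X" "vnorm Y = vnorm X"
    and "\<And>x y. x \<in> carrier Y \<Longrightarrow> y \<in> carrier Y \<Longrightarrow> vadd X x y \<in> carrier Y"
    and "\<And>c x. x \<in> carrier Y \<Longrightarrow> vscale X c x \<in> carrier Y"
  shows "normed_nspace Y"
proof -
  interpret X: normed_nspace X by fact
  note [dest] = subsetD[OF sub]
  show ?thesis
    by unfold_locales
      (use assms(6,7) in \<open>auto simp: ops intro: X.add_assoc X.add_commute X.add_zero
         X.scale_add_right X.scale_add_left X.scale_scale X.scale_one X.norm_scale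
         X.norm_triangle X.norm_eq_zero\<close>)
qed


section \<open>Mid p-summable sequences\<close>

text \<open>The supremum that defines the dual norm is one of real numbers, hence an upper bound only once
  the values are known to be bounded; boundedness of \<open>f\<close> yields this.\<close>

lemma dual_apply_le:
  assumes "\<And>x. x \<in> carrier V \<Longrightarrow> vnorm V x \<ge> 0" "f \<in> carrier (dual V)" "x \<in> unit_ball V"
  shows "norm (f x) \<le> vnorm (dual V) f"
proof -
  obtain C where C: "\<And>x. x \<in> carrier V \<Longrightarrow> norm (f x) \<le> C * vnorm V x"
    using assms(2) by (simp add: dual_def) blast
  have "norm (f x) \<le> \<bar>C\<bar>" if "x \<in> unit_ball V" for x
  proof -
    have x: "x \<in> carrier V" "vnorm V x \<le> 1" using that by (auto simp: unit_ball_def)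
    have "C * vnorm V x \<le> \<bar>C\<bar> * 1"
      using x assms(1)[of x] by (intro mult_mono) auto
    then show ?thesis using C[OF x(1)] by simp
  qed
  then have "bdd_above ((\<lambda>x. norm (f x)) ` unit_ball V)" by (intro bdd_aboveI2) auto
  from cSUP_upper[OF assms(3) this] show ?thesis by (simp add: dual_def)
qed

lemma dual_norm_leI:
  assumes "unit_ball V \<noteq> {}" "\<And>x. x \<in> unit_ball V \<Longrightarrow> norm (f x) \<le> c"
  shows "vnorm (dual V) f \<le> c"
  using assms by (simp add: dual_def cSUP_least)

context banach_space_over
begin

abbreviation E :: "('k, 'e) nspace" where "E \<equiv> nspace_of scaleK"

abbreviation weak_ball :: "real \<Rightarrow> (nat \<Rightarrow> 'e \<Rightarrow> 'k) set" where
  "weak_ball p \<equiv> unit_ball (ell_weak p (dual E))"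

lemma E_simps [simp]:
  "carrier E = UNIV" "vadd E = (+)" "vscale E = scaleK" "vnorm E = norm"
  by (auto simp: nspace_of_def)

lemma scaleK_minus_one: "scaleK (- 1) x = - x"
  by (simp add: scale_minus_left)

lemma mem_dual_E: "f \<in> carrier (dual E) \<longleftrightarrow>
    (\<forall>x y. f (x + y) = f x + f y) \<and> (\<forall>c x. f (scaleK c x) = c * f x) \<and>
    (\<exists>C. \<forall>x. norm (f x) \<le> C * norm x)"
  by (auto simp: dual_def)

lemma dual_E_linear:
  assumes "f \<in> carrier (dual E)"
  shows "f (x + y) = f x + f y" "f (scaleK c x) = c * f x" "f 0 = 0" "f (x - y) = f x - f y"
    "f (sum_list xs) = sum_list (map f xs)"
proof -
  show add: "f (x + y) = f x + f y" for x y using assms by (simp add: mem_dual_E)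
  show "f (scaleK c x) = c * f x" using assms by (simp add: mem_dual_E)
  show zero: "f 0 = 0" using add[of 0 0] by simp
  show "f (x - y) = f x - f y" using add[of "x - y" y] by simp
  show "f (sum_list xs) = sum_list (map f xs)" by (induction xs) (auto simp: add zero)
qed

lemma dual_E_tendsto:
  assumes "f \<in> carrier (dual E)" "(g \<longlongrightarrow> l) F"
  shows "((\<lambda>n. f (g n)) \<longlongrightarrow> f l) F"
proof -
  obtain C where "\<And>x. norm (f x) \<le> C * norm x" using assms by (auto simp: mem_dual_E)
  then have "bounded_linear f"
    using dual_E_linear(1)[OF assms(1)] dual_E_linear(2)[OF assms(1), of "of_real _"]
    by (intro bounded_linear_intro[of _ C])
       (auto simp: scaleK_of_real scaleR_conv_of_real mult.commute)
  then show ?thesis using assms(2) by (rule bounded_linear.tendsto)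
qed

lemma unit_ball_E [simp]: "unit_ball E = cball 0 1"
  by (auto simp: unit_ball_def)

lemma dual_E_norm_nonneg:
  assumes "f \<in> carrier (dual E)"
  shows "vnorm (dual E) f \<ge> 0"
  using dual_apply_le[of E f 0] assms by (simp add: dual_E_linear)

lemma dual_E_apply_le:
  assumes f: "f \<in> carrier (dual E)"
  shows "norm (f x) \<le> vnorm (dual E) f * norm x"
proof (cases "x = 0")
  case False
  let ?y = "scaleK (of_real (inverse (norm x))) x"
  have "norm (f ?y) \<le> vnorm (dual E) f"
    using False by (intro dual_apply_le f) (auto simp: norm_scaleK norm_inverse)
  then show ?thesis using False
    by (simp add: dual_E_linear(2)[OF f] norm_mult norm_inverse norm_divide field_simps)
qed (simp add: dual_E_linear[OF f])

lemma dual_E_add_closed: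
  assumes "f \<in> carrier (dual E)" "g \<in> carrier (dual E)"
  shows "vadd (dual E) f g \<in> carrier (dual E)"
proof -
  obtain C D where "\<And>x. norm (f x) \<le> C * norm x" "\<And>x. norm (g x) \<le> D * norm x"
    using assms by (auto simp: mem_dual_E)
  then have "norm (f x + g x) \<le> (C + D) * norm x" for x
    by (smt (verit) norm_triangle_ineq distrib_right)
  then have "\<exists>C. \<forall>x. norm (f x + g x) \<le> C * norm x" by blast
  then show ?thesis
    using assms by (simp add: dual_def algebra_simps)
qed

lemma dual_E_scale_closed:
  assumes "f \<in> carrier (dual E)"
  shows "vscale (dual E) c f \<in> carrier (dual E)"
proof -
  obtain C where "\<And>x. norm (f x) \<le> C * norm x" using assms by (auto simp: mem_dual_E)
  then have "norm (c * f x) \<le> (norm c * C) * norm x" for x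
    by (simp add: norm_mult mult.assoc mult_left_mono)
  then have "\<exists>C. \<forall>x. norm (c * f x) \<le> C * norm x" by blast
  then show ?thesis
    using assms by (simp add: dual_def algebra_simps)
qed

lemma dual_E_norm_leI: "(\<And>x. norm x \<le> 1 \<Longrightarrow> norm (f x) \<le> c) \<Longrightarrow> vnorm (dual E) f \<le> c"
  by (rule dual_norm_leI) auto

lemma zero_functional: "(\<lambda>_. 0) \<in> unit_ball (dual E)"
  by (auto simp: unit_ball_def mem_dual_E intro!: dual_E_norm_leI exI[of _ 0])

text \<open>The canonical embedding of \<open>E\<close> into its bidual, which gives access to the weak norm of a
  sequence of functionals, a supremum over the ball of the bidual.\<close>

lemma evaluation_in_bidual_ball:
  assumes "norm x \<le> 1"
  shows "restrict (\<lambda>f. f x) (carrier (dual E)) \<in> unit_ball (dual (dual E))"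
proof -
  have "norm (f x) \<le> 1 * vnorm (dual E) f" if "f \<in> carrier (dual E)" for f
    using dual_E_apply_le[OF that, of x] mult_left_mono[OF assms dual_E_norm_nonneg[OF that]]
    by simp
  then have "restrict (\<lambda>f. f x) (carrier (dual E)) \<in> carrier (dual (dual E))"
    using dual_E_add_closed dual_E_scale_closed
    by (subst dual_def) (auto intro!: exI[of _ 1], auto simp: dual_def)
  moreover have "vnorm (dual (dual E)) (restrict (\<lambda>f. f x) (carrier (dual E))) \<le> 1"
  proof (rule dual_norm_leI)
    fix f assume f: "f \<in> unit_ball (dual E)"
    then have "norm (f x) \<le> vnorm (dual E) f"
      using assms by (intro dual_apply_le) (auto simp: unit_ball_def)
    then show "norm (restrict (\<lambda>f. f x) (carrier (dual E)) f) \<le> 1"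
      using f by (simp add: unit_ball_def)
  qed (use zero_functional in blast)
  ultimately show ?thesis by (simp add: unit_ball_def)
qed

lemma weak_ball_functional: "\<phi> \<in> weak_ball p \<Longrightarrow> \<phi> n \<in> carrier (dual E)"
  by (auto simp: mem_unit_ball_ell_weak)

lemma weak_ball_pointwise:
  assumes p: "1 \<le> p" and \<phi>: "\<phi> \<in> weak_ball p"
  shows "(\<Sum>n<N. norm (\<phi> n x) powr p) \<le> norm x powr p"
proof (cases "x = 0")
  case True
  then show ?thesis by (simp add: dual_E_linear[OF weak_ball_functional[OF \<phi>]])
next
  case False
  let ?y = "scaleK (of_real (inverse (norm x))) x"
  have y: "norm ?y \<le> 1" using False by (simp add: norm_scaleK norm_inverse)
  have "lp_norm (ennreal p) (\<lambda>n. norm (restrict (\<lambda>f. f ?y) (carrier (dual E)) (\<phi> n)))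
      \<le> weak_norm p (dual E) \<phi>"
    unfolding weak_norm_def by (rule SUP_upper[OF evaluation_in_bidual_ball[OF y]])
  also have "\<dots> \<le> ennreal 1" using \<phi> by (simp add: mem_unit_ball_ell_weak)
  finally have "(\<Sum>n<N. norm (\<phi> n ?y) powr p) \<le> 1"
    using p weak_ball_functional[OF \<phi>] by (simp add: lp_norm_le_iff del: ennreal_1)
  moreover have "norm (\<phi> n ?y) powr p = norm (\<phi> n x) powr p / norm x powr p" for n
    by (simp add: dual_E_linear(2)[OF weak_ball_functional[OF \<phi>]] norm_mult norm_inverse
        norm_divide powr_divide field_simps)
  ultimately have "(\<Sum>n<N. norm (\<phi> n x) powr p) / norm x powr p \<le> 1"
    by (simp only: sum_divide_distrib)
  then show ?thesis using False by (simp add: field_simps)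
qed

text \<open>Makes single functionals available as test sequences for the mid norm, so that the mid norm
  controls each term of a sequence.\<close>

lemma weak_ball_single:
  assumes p: "1 \<le> p" and f: "f \<in> unit_ball (dual E)"
  shows "(\<lambda>n. if n = 0 then f else (\<lambda>_. 0)) \<in> weak_ball p"
proof -
  have "lp_norm (ennreal p) (\<lambda>n. norm (\<Phi> (if n = 0 then f else (\<lambda>_. 0)))) \<le> ennreal 1"
    if \<Phi>: "\<Phi> \<in> unit_ball (dual (dual E))" for \<Phi>
  proof -
    have \<Phi>c: "\<Phi> \<in> carrier (dual (dual E))" using \<Phi> by (simp add: unit_ball_def)
    have "vscale (dual E) 0 f = (\<lambda>_. 0)" by (simp add: dual_def restrict_def)
    moreover have "\<Phi> (vscale (dual E) 0 f) = 0 * \<Phi> f"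
      using \<Phi>c f unfolding dual_def[of "dual E"] by (simp add: unit_ball_def)
    ultimately have zero: "\<Phi> (\<lambda>_. 0) = 0" by simp
    have "norm (\<Phi> f) \<le> vnorm (dual (dual E)) \<Phi>"
      by (rule dual_apply_le[OF dual_E_norm_nonneg \<Phi>c f])
    then have "norm (\<Phi> f) \<le> 1" using \<Phi> by (simp add: unit_ball_def)
    then have "norm (\<Phi> f) powr p \<le> 1" using p powr_mono2[of p "norm (\<Phi> f)" 1] by simp
    then have "(\<Sum>n<N. if n = 0 then norm (\<Phi> f) powr p else 0) \<le> 1" for N :: nat
      by simp
    moreover have "(\<Sum>n<N. norm (\<Phi> (if n = 0 then f else (\<lambda>_. 0))) powr p)
        = (\<Sum>n<N. if n = 0 then norm (\<Phi> f) powr p else 0)" for N :: nat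
      by (rule sum.cong) (auto simp: zero)
    ultimately have "(\<Sum>n<N. norm (\<Phi> (if n = 0 then f else (\<lambda>_. 0))) powr p) \<le> 1" for N :: nat
      by metis
    then show ?thesis using p by (subst lp_norm_le_iff) auto
  qed
  then have "weak_norm p (dual E) (\<lambda>n. if n = 0 then f else (\<lambda>_. 0)) \<le> ennreal 1"
    unfolding weak_norm_def by (rule SUP_least)
  moreover have "f \<in> carrier (dual E)" "(\<lambda>_. 0) \<in> carrier (dual E)"
    using f zero_functional by (simp_all add: unit_ball_def)
  ultimately show ?thesis by (auto simp: mem_unit_ball_ell_weak)
qed

lemma weak_ball_nonempty: "1 \<le> p \<Longrightarrow> weak_ball p \<noteq> {}"
  using weak_ball_single[OF _ zero_functional] by blast

lemma mid_norm_le_iff: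
  assumes "1 \<le> p" "0 \<le> c"
  shows "mid_norm p E x \<le> ennreal c \<longleftrightarrow>
    (\<forall>\<phi>\<in>weak_ball p. \<forall>N M. (\<Sum>n<N. \<Sum>j<M. norm (\<phi> n (x j)) powr p) \<le> c powr p)"
  using assms by (simp add: mid_norm_def SUP_le_iff ennreal_powr_le_iff suminf2_ennreal_le_iff)

text \<open>The mid norm as a supremum of moduli of linear functionals that depend continuously on finitely
  many terms of \<open>x\<close>. In this form the triangle inequality, homogeneity and
  stability under termwise limits are inherited from the functionals.\<close>

lemma mid_norm_le_iff_dual:
  assumes "1 \<le> p" "0 \<le> c"
  shows "mid_norm p E x \<le> ennreal c \<longleftrightarrow>
    (\<forall>\<phi>\<in>weak_ball p. \<forall>\<psi>\<in>double_ball p. \<forall>N M.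
      norm (\<Sum>n<N. \<Sum>j<M. \<psi> n j * \<phi> n (x j)) \<le> c)"
  using assms by (simp add: mid_norm_le_iff lp_sum_le_iff_dual) blast

lemma ell_mid_simps [simp]:
  "carrier (ell_mid p E) = {x. mid_norm p E x < \<infinity>}"
  "vadd (ell_mid p E) x y = (\<lambda>j. x j + y j)"
  "vscale (ell_mid p E) c x = (\<lambda>j. scaleK c (x j))"
  "vnorm (ell_mid p E) x = enn2real (mid_norm p E x)"
  by (auto simp: ell_mid_def seq_space_def)

lemma ell_mid_u_simps [simp]:
  "carrier (ell_mid_u p E) = {x. mid_norm p E x < \<infinity> \<and>
     (\<lambda>n. enn2real (mid_norm p E (\<lambda>j. x (n + j)))) \<longlonglongrightarrow> 0}"
  "vadd (ell_mid_u p E) x y = (\<lambda>j. x j + y j)"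
  "vscale (ell_mid_u p E) c x = (\<lambda>j. scaleK c (x j))"
  "vnorm (ell_mid_u p E) x = enn2real (mid_norm p E x)"
  by (auto simp: ell_mid_u_def seq_space_def)

lemma mid_norm_leD:
  assumes "mid_norm p E x \<le> ennreal c" "0 \<le> c"
  shows "mid_norm p E x < \<infinity>" "enn2real (mid_norm p E x) \<le> c"
  using order.strict_trans1[OF assms(1) ennreal_less_top] assms by (auto simp: enn2real_leI)

lemma mid_norm_le_self: "mid_norm p E x < \<infinity> \<Longrightarrow> mid_norm p E x \<le> ennreal (enn2real (mid_norm p E x))"
  by simp

lemma mid_norm_add_le:
  assumes "1 \<le> p" "0 \<le> a" "0 \<le> b" "mid_norm p E x \<le> ennreal a" "mid_norm p E y \<le> ennreal b"
  shows "mid_norm p E (\<lambda>j. x j + y j) \<le> ennreal (a + b)"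
proof -
  have "norm (\<Sum>n<N. \<Sum>j<M. \<psi> n j * \<phi> n (x j + y j)) \<le> a + b"
    if \<phi>: "\<phi> \<in> weak_ball p" and \<psi>: "\<psi> \<in> double_ball p" for \<phi> \<psi> N M
  proof -
    have "(\<Sum>n<N. \<Sum>j<M. \<psi> n j * \<phi> n (x j + y j)) =
        (\<Sum>n<N. \<Sum>j<M. \<psi> n j * \<phi> n (x j)) + (\<Sum>n<N. \<Sum>j<M. \<psi> n j * \<phi> n (y j))"
      by (simp add: dual_E_linear[OF weak_ball_functional[OF \<phi>]] distrib_left sum.distrib)
    also have "norm \<dots> \<le> a + b"
      using assms \<phi> \<psi> by (intro norm_triangle_le add_mono) (auto simp: mid_norm_le_iff_dual)
    finally show ?thesis .
  qed
  then show ?thesis using assms by (subst mid_norm_le_iff_dual) auto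
qed

lemma mid_norm_scale_le:
  assumes "1 \<le> p" "0 \<le> a" "mid_norm p E x \<le> ennreal a"
  shows "mid_norm p E (\<lambda>j. scaleK c (x j)) \<le> ennreal (norm c * a)"
proof -
  have "norm (\<Sum>n<N. \<Sum>j<M. \<psi> n j * \<phi> n (scaleK c (x j))) \<le> norm c * a"
    if \<phi>: "\<phi> \<in> weak_ball p" and \<psi>: "\<psi> \<in> double_ball p" for \<phi> \<psi> N M
  proof -
    have "(\<Sum>n<N. \<Sum>j<M. \<psi> n j * \<phi> n (scaleK c (x j))) =
        c * (\<Sum>n<N. \<Sum>j<M. \<psi> n j * \<phi> n (x j))"
      by (simp add: dual_E_linear[OF weak_ball_functional[OF \<phi>]] sum_distrib_left mult.left_commute)
    then show ?thesis
      using assms \<phi> \<psi> by (simp add: norm_mult mid_norm_le_iff_dual mult_left_mono)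
  qed
  then show ?thesis using assms by (simp add: mid_norm_le_iff_dual)
qed

text \<open>Tested on the sequence \<open>(f, 0, 0, \<dots>)\<close> with \<open>f\<close> norming \<open>x j\<close>.\<close>

lemma norm_coordinate_le_mid_norm:
  assumes p: "1 \<le> p" and x: "mid_norm p E x < \<infinity>"
  shows "norm (x j) \<le> enn2real (mid_norm p E x)"
proof -
  let ?c = "enn2real (mid_norm p E x)"
  obtain f where f: "\<And>y z. f (y + z) = f y + f z" "\<And>c y. f (scaleK c y) = c * f y"
    "\<And>y. norm (f y) \<le> norm y" "norm (f (x j)) = norm (x j)"
    using norming_functional[of "x j"] by blast
  have "f \<in> unit_ball (dual E)"
    using f(1-3) by (auto simp: unit_ball_def mem_dual_E
        intro!: exI[of _ 1] dual_E_norm_leI intro: order_trans[OF f(3)])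
  then have "(\<Sum>n<(1::nat). \<Sum>i<Suc j. norm ((if n = 0 then f else (\<lambda>_. 0)) (x i)) powr p) \<le> ?c powr p"
    by (rule mid_norm_le_iff[OF p enn2real_nonneg, THEN iffD1, OF mid_norm_le_self[OF x],
          rule_format, OF weak_ball_single[OF p]])
  then have "(\<Sum>i<Suc j. norm (f (x i)) powr p) \<le> ?c powr p" by simp
  moreover have "norm (f (x j)) powr p \<le> (\<Sum>i<Suc j. norm (f (x i)) powr p)"
    by (rule member_le_sum) auto
  ultimately have "norm (x j) powr p \<le> ?c powr p" using f(4) by simp
  then show ?thesis
    using p powr_less_mono2[of p ?c "norm (x j)"]
    by (meson enn2real_nonneg less_le_trans linorder_not_less zero_less_one)
qed

lemma normed_nspace_ell_mid:
  assumes p: "1 \<le> p"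
  shows "normed_nspace (ell_mid p E)"
proof
  note scale_le = mid_norm_scale_le[OF p enn2real_nonneg mid_norm_le_self]
  note add_le = mid_norm_add_le[OF p enn2real_nonneg enn2real_nonneg mid_norm_le_self mid_norm_le_self]
  show "vadd (ell_mid p E) x y \<in> carrier (ell_mid p E)"
    if "x \<in> carrier (ell_mid p E)" "y \<in> carrier (ell_mid p E)" for x y
    using mid_norm_leD(1)[OF add_le[of x y]] that by simp
  show "vscale (ell_mid p E) c x \<in> carrier (ell_mid p E)" if "x \<in> carrier (ell_mid p E)" for c x
    using mid_norm_leD(1)[OF scale_le[of x c]] that by simp
  show "vnorm (ell_mid p E) (vadd (ell_mid p E) x y) \<le> vnorm (ell_mid p E) x + vnorm (ell_mid p E) y"
    if "x \<in> carrier (ell_mid p E)" "y \<in> carrier (ell_mid p E)" for x y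
    using mid_norm_leD(2)[OF add_le[of x y]] that by simp
  have le: "enn2real (mid_norm p E (\<lambda>j. scaleK c (x j))) \<le> norm c * enn2real (mid_norm p E x)"
    "mid_norm p E (\<lambda>j. scaleK c (x j)) < \<infinity>"
    if "mid_norm p E x < \<infinity>" for c x
    using mid_norm_leD[OF scale_le[OF that, of c]] by simp_all
  show "vnorm (ell_mid p E) (vscale (ell_mid p E) c x) = norm c * vnorm (ell_mid p E) x"
    if "x \<in> carrier (ell_mid p E)" for c x
  proof (rule antisym)
    have x: "mid_norm p E x < \<infinity>" using that by simp
    show "vnorm (ell_mid p E) (vscale (ell_mid p E) c x) \<le> norm c * vnorm (ell_mid p E) x"
      using le(1)[OF x] by simp
    show "norm c * vnorm (ell_mid p E) x \<le> vnorm (ell_mid p E) (vscale (ell_mid p E) c x)"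
    proof (cases "c = 0")
      case False
      then show ?thesis
        using le(1)[OF le(2)[OF x, of c], of "inverse c"]
        by (simp add: norm_inverse norm_divide field_simps)
    qed simp
  qed
  show "x = vscale (ell_mid p E) 0 x" if "x \<in> carrier (ell_mid p E)" "vnorm (ell_mid p E) x = 0" for x
    using that norm_coordinate_le_mid_norm[OF p, of x] by (auto simp: fun_eq_iff)
qed (auto simp: algebra_simps)

lemma mid_norm_tail_le:
  assumes "1 \<le> p" "0 \<le> c" "mid_norm p E x \<le> ennreal c"
  shows "mid_norm p E (\<lambda>j. x (m + j)) \<le> ennreal c"
proof -
  have "(\<Sum>n<N. \<Sum>j<M. norm (\<phi> n (x (m + j))) powr p) \<le> c powr p"
    if \<phi>: "\<phi> \<in> weak_ball p" for \<phi> N M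
  proof -
    have "(\<Sum>j<M. norm (\<phi> n (x (m + j))) powr p) = (\<Sum>j\<in>{m..<m + M}. norm (\<phi> n (x j)) powr p)" for n
      using sum.shift_bounds_nat_ivl[of "\<lambda>j. norm (\<phi> n (x j)) powr p" 0 m M]
      by (simp add: add.commute lessThan_atLeast0)
    also have "\<dots> n \<le> (\<Sum>j<m + M. norm (\<phi> n (x j)) powr p)" for n
      by (rule sum_mono2) auto
    finally have "(\<Sum>n<N. \<Sum>j<M. norm (\<phi> n (x (m + j))) powr p)
        \<le> (\<Sum>n<N. \<Sum>j<m + M. norm (\<phi> n (x j)) powr p)"
      by (rule sum_mono)
    also have "\<dots> \<le> c powr p" using assms \<phi> by (simp add: mid_norm_le_iff)
    finally show ?thesis .
  qed
  then show ?thesis using assms by (simp add: mid_norm_le_iff)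
qed

text \<open>Overwriting initial terms by zero costs no more than shifting them away, as functionals
  vanish at \<open>0\<close>.\<close>

lemma mid_norm_drop_le:
  assumes "1 \<le> p" "0 \<le> c" "mid_norm p E (\<lambda>j. x (m + j)) \<le> ennreal c"
  shows "mid_norm p E (\<lambda>j. if j < m then 0 else x j) \<le> ennreal c"
proof -
  have "(\<Sum>n<N. \<Sum>j<M. norm (\<phi> n (if j < m then 0 else x j)) powr p) \<le> c powr p"
    if \<phi>: "\<phi> \<in> weak_ball p" for \<phi> N M
  proof -
    have "(\<Sum>j<M. norm (\<phi> n (if j < m then 0 else x j)) powr p)
        \<le> (\<Sum>j<m + M. norm (\<phi> n (if j < m then 0 else x j)) powr p)" for n
      by (rule sum_mono2) auto
    also have "\<dots> n = (\<Sum>j\<in>{m..<m + M}. norm (\<phi> n (x j)) powr p)" for n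
      by (rule sum.mono_neutral_cong_right)
        (auto simp: dual_E_linear[OF weak_ball_functional[OF \<phi>]])
    also have "\<dots> n = (\<Sum>j<M. norm (\<phi> n (x (m + j))) powr p)" for n
      using sum.shift_bounds_nat_ivl[of "\<lambda>j. norm (\<phi> n (x j)) powr p" 0 m M]
      by (simp add: add.commute lessThan_atLeast0)
    finally have "(\<Sum>n<N. \<Sum>j<M. norm (\<phi> n (if j < m then 0 else x j)) powr p)
        \<le> (\<Sum>n<N. \<Sum>j<M. norm (\<phi> n (x (m + j))) powr p)"
      by (rule sum_mono)
    also have "\<dots> \<le> c powr p" using assms \<phi> by (simp add: mid_norm_le_iff)
    finally show ?thesis .
  qed
  then show ?thesis using assms by (simp add: mid_norm_le_iff)
qed

lemma normed_nspace_ell_mid_u: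
  assumes p: "1 \<le> p"
  shows "normed_nspace (ell_mid_u p E)"
proof (rule normed_nspace_subspace[OF normed_nspace_ell_mid[OF p]])
  interpret M: normed_nspace "ell_mid p E" by (rule normed_nspace_ell_mid[OF p])
  let ?N = "\<lambda>x. enn2real (mid_norm p E x)"
  have tail: "mid_norm p E (\<lambda>j. x (n + j)) < \<infinity>" if "mid_norm p E x < \<infinity>" for x n
    using mid_norm_leD(1)[OF mid_norm_tail_le[OF p _ mid_norm_le_self[OF that]]] by simp
  show "vadd (ell_mid p E) x y \<in> carrier (ell_mid_u p E)"
    if x: "x \<in> carrier (ell_mid_u p E)" and y: "y \<in> carrier (ell_mid_u p E)" for x y
  proof -
    have "(\<lambda>n. ?N (\<lambda>j. x (n + j) + y (n + j))) \<longlonglongrightarrow> 0"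
    proof (rule tendsto_sandwich[OF _ _ tendsto_const])
      show "(\<lambda>n. ?N (\<lambda>j. x (n + j)) + ?N (\<lambda>j. y (n + j))) \<longlonglongrightarrow> 0"
        using x y tendsto_add[of "\<lambda>n. ?N (\<lambda>j. x (n + j))" 0 _ "\<lambda>n. ?N (\<lambda>j. y (n + j))" 0] by simp
      show "\<forall>\<^sub>F n in sequentially. ?N (\<lambda>j. x (n + j) + y (n + j)) \<le> ?N (\<lambda>j. x (n + j)) + ?N (\<lambda>j. y (n + j))"
        using M.norm_triangle tail x y by (intro always_eventually) simp
    qed auto
    then show ?thesis using M.add_closed[of x y] x y by simp
  qed
  show "vscale (ell_mid p E) c x \<in> carrier (ell_mid_u p E)"
    if x: "x \<in> carrier (ell_mid_u p E)" for c x
  proof -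
    have "?N (\<lambda>j. scaleK c (x (n + j))) = norm c * ?N (\<lambda>j. x (n + j))" for n
      using M.norm_scale[of "\<lambda>j. x (n + j)" c] tail[of x n] x by simp
    then show ?thesis using M.scale_closed[of x c] x by (simp add: tendsto_mult_right_zero)
  qed
qed (auto simp: fun_eq_iff)

text \<open>The termwise limit \<open>x\<close> of a Cauchy sequence exists since the mid norm dominates the terms.
  Each functional in \<open>mid_norm_le_iff_dual\<close> passes to the limit, so \<open>x\<close> is also the limit in norm;
  and its tails are small because shifting does not increase the norm and so brings them
  uniformly close to the tails of some \<open>s k\<close>.\<close>

lemma ell_mid_u_complete:
  assumes p: "1 \<le> p" and s: "s \<in> cauchy_seqs (ell_mid_u p E)"
  shows "\<exists>x\<in>carrier (ell_mid_u p E). (\<lambda>n. vdist (ell_mid_u p E) (s n) x) \<longlonglongrightarrow> 0"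
proof -
  let ?N = "\<lambda>x. enn2real (mid_norm p E x)"
  interpret M: normed_nspace "ell_mid p E" by (rule normed_nspace_ell_mid[OF p])
  interpret U: normed_nspace "ell_mid_u p E" by (rule normed_nspace_ell_mid_u[OF p])
  have vd: "vdist (ell_mid_u p E) x y = ?N (\<lambda>j. x j - y j)" for x y
    by (simp add: vdist_def scaleK_minus_one)
  have diff_fin: "mid_norm p E (\<lambda>j. x j - y j) < \<infinity>"
    if "mid_norm p E x < \<infinity>" "mid_norm p E y < \<infinity>" for x y
    using M.diff_closed[of x y] that by (simp add: scaleK_minus_one)
  have sc: "s k \<in> carrier (ell_mid_u p E)" for k using s by (auto simp: cauchy_seqs_def)
  have fin: "mid_norm p E (s k) < \<infinity>" for k using sc[of k] by simp
  have cau: "\<exists>K. \<forall>k\<ge>K. \<forall>l\<ge>K. ?N (\<lambda>j. s k j - s l j) < e" if "e > 0" for e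
    using s that by (auto simp: cauchy_seqs_def vd)
  have "Cauchy (\<lambda>k. s k j)" for j
  proof (rule CauchyI)
    fix e :: real assume "e > 0"
    then obtain K where K: "\<And>k l. k \<ge> K \<Longrightarrow> l \<ge> K \<Longrightarrow> ?N (\<lambda>j. s k j - s l j) < e" using cau by blast
    have "norm (s k j - s l j) < e" if "k \<ge> K" "l \<ge> K" for k l
      using norm_coordinate_le_mid_norm[OF p diff_fin[OF fin[of k] fin[of l]], of j] K[OF that] by simp
    then show "\<exists>K. \<forall>k\<ge>K. \<forall>l\<ge>K. norm (s k j - s l j) < e" by blast
  qed
  then have "\<forall>j. \<exists>l. (\<lambda>k. s k j) \<longlonglongrightarrow> l" by (simp add: Cauchy_convergent_iff convergent_def)
  then obtain x where x: "\<And>j. (\<lambda>k. s k j) \<longlonglongrightarrow> x j" by metis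
  have approx: "\<exists>K. \<forall>k\<ge>K. mid_norm p E (\<lambda>j. s k j - x j) \<le> ennreal e" if e: "e > 0" for e
  proof -
    obtain K where K: "\<And>k l. k \<ge> K \<Longrightarrow> l \<ge> K \<Longrightarrow> ?N (\<lambda>j. s k j - s l j) < e" using cau[OF e] by blast
    have "norm (\<Sum>n<N. \<Sum>j<M. \<psi> n j * \<phi> n (s k j - x j)) \<le> e"
      if k: "k \<ge> K" and \<phi>: "\<phi> \<in> weak_ball p" and \<psi>: "\<psi> \<in> double_ball p" for k \<phi> \<psi> N M
    proof (rule LIMSEQ_le_const2)
      show "(\<lambda>l. norm (\<Sum>n<N. \<Sum>j<M. \<psi> n j * \<phi> n (s k j - s l j)))
          \<longlonglongrightarrow> norm (\<Sum>n<N. \<Sum>j<M. \<psi> n j * \<phi> n (s k j - x j))"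
        by (intro tendsto_intros dual_E_tendsto weak_ball_functional[OF \<phi>] x)
      have "norm (\<Sum>n<N. \<Sum>j<M. \<psi> n j * \<phi> n (s k j - s l j)) \<le> e" if "l \<ge> K" for l
      proof -
        have "mid_norm p E (\<lambda>j. s k j - s l j) \<le> ennreal (?N (\<lambda>j. s k j - s l j))"
          by (rule mid_norm_le_self[OF diff_fin[OF fin fin]])
        then have "mid_norm p E (\<lambda>j. s k j - s l j) \<le> ennreal e"
          using K[OF k that] by (meson ennreal_leI less_imp_le order_trans)
        then show ?thesis using p e \<phi> \<psi> by (simp add: mid_norm_le_iff_dual)
      qed
      then show "\<exists>K. \<forall>l\<ge>K. norm (\<Sum>n<N. \<Sum>j<M. \<psi> n j * \<phi> n (s k j - s l j)) \<le> e" by blast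
    qed
    then have "mid_norm p E (\<lambda>j. s k j - x j) \<le> ennreal e" if "k \<ge> K" for k
      using p e that by (subst mid_norm_le_iff_dual) auto
    then show ?thesis by blast
  qed
  obtain k where "mid_norm p E (\<lambda>j. s k j - x j) \<le> ennreal 1" using approx[of 1] by auto
  then have "mid_norm p E (\<lambda>j. s k j - x j) < \<infinity>" by (rule mid_norm_leD) simp
  from diff_fin[OF fin this, of k] have x_fin: "mid_norm p E x < \<infinity>" by simp
  have "(\<lambda>m. ?N (\<lambda>j. x (m + j))) \<longlonglongrightarrow> 0"
  proof (rule LIMSEQ_I)
    fix e :: real assume e: "e > 0"
    obtain k where k: "mid_norm p E (\<lambda>j. s k j - x j) \<le> ennreal (e / 3)"
      using approx[of "e / 3"] e by auto
    have "mid_norm p E (\<lambda>j. scaleK (- 1) (s k j - x j)) \<le> ennreal (norm (- 1 :: 'k) * (e / 3))"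
      using e by (intro mid_norm_scale_le[OF p _ k]) simp
    then have xk: "mid_norm p E (\<lambda>j. x j - s k j) \<le> ennreal (e / 3)"
      by (simp add: scaleK_minus_one)
    obtain m0 where m0: "\<And>m. m \<ge> m0 \<Longrightarrow> norm (?N (\<lambda>j. s k (m + j)) - 0) < e / 3"
      using LIMSEQ_D[of "\<lambda>m. ?N (\<lambda>j. s k (m + j))" 0 "e / 3"] sc[of k] e by auto
    have "norm (?N (\<lambda>j. x (m + j)) - 0) < e" if "m \<ge> m0" for m
    proof -
      have tl: "mid_norm p E (\<lambda>j. x (m + j) - s k (m + j)) \<le> ennreal (e / 3)"
        using mid_norm_tail_le[OF p _ xk, of m] e by simp
      have "mid_norm p E (\<lambda>j. s k (m + j)) \<le> ennreal (?N (\<lambda>j. s k (m + j)))"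
        using mid_norm_leD(1)[OF mid_norm_tail_le[OF p _ mid_norm_le_self[OF fin]]]
        by (intro mid_norm_le_self) simp
      also have "\<dots> \<le> ennreal (e / 3)" using m0[OF that] by (intro ennreal_leI) simp
      finally have "mid_norm p E (\<lambda>j. s k (m + j)) \<le> ennreal (e / 3)" .
      from mid_norm_add_le[OF p _ _ tl this] e
      have "mid_norm p E (\<lambda>j. x (m + j)) \<le> ennreal (e / 3 + e / 3)" by simp
      from mid_norm_leD(2)[OF this] e show ?thesis by simp
    qed
    then show "\<exists>m0. \<forall>m\<ge>m0. norm (?N (\<lambda>j. x (m + j)) - 0) < e" by blast
  qed
  then have "x \<in> carrier (ell_mid_u p E)" using x_fin by simp
  moreover have "(\<lambda>k. vdist (ell_mid_u p E) (s k) x) \<longlonglongrightarrow> 0"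
  proof (rule LIMSEQ_I)
    fix e :: real assume e: "e > 0"
    then obtain K where K: "\<And>k. k \<ge> K \<Longrightarrow> mid_norm p E (\<lambda>j. s k j - x j) \<le> ennreal (e / 2)"
      using approx[of "e / 2"] by auto
    have "norm (vdist (ell_mid_u p E) (s k) x - 0) < e" if "k \<ge> K" for k
      using mid_norm_leD(2)[OF K[OF that]] e by (simp add: vd)
    then show "\<exists>K. \<forall>k\<ge>K. norm (vdist (ell_mid_u p E) (s k) x - 0) < e" by blast
  qed
  ultimately show ?thesis by blast
qed

end


section \<open>The algebraic tensor product\<close>

lemma mem_tensor_class: "g \<in> tensor_class V W f \<longleftrightarrow> g - f \<in> free.span (bilinear_relations V W)"
  by (auto simp: tensor_class_def intro!: exI[of _ "g - f"])

lemma tensor_class_self: "f \<in> tensor_class V W f"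
  by (simp add: mem_tensor_class free.span_zero)

lemma tensor_class_nonempty: "tensor_class V W f \<noteq> {}"
  using tensor_class_self by blast

lemma tensor_class_eqI:
  assumes "f - g \<in> free.span (bilinear_relations V W)"
  shows "tensor_class V W f = tensor_class V W g"
proof -
  have "h - f \<in> free.span (bilinear_relations V W) \<longleftrightarrow>
      h - g \<in> free.span (bilinear_relations V W)" for h
    using free.span_add[OF _ assms, of "h - f"] free.span_diff[OF _ assms, of "h - g"]
    by (auto simp: algebra_simps)
  then show ?thesis by (auto simp: mem_tensor_class)
qed

lemma tensor_space_simps [simp]:
  "carrier (tensor_space V W N) = tensor_class V W ` free_on V W"
  "vnorm (tensor_space V W N) = N"
  by (simp_all add: tensor_space_def)

lemma tensor_space_add:
  "vadd (tensor_space V W N) (tensor_class V W f) (tensor_class V W g) = tensor_class V W (f + g)"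
proof -
  have "tensor_class V W (f' + g') = tensor_class V W (f + g)"
    if "f' \<in> tensor_class V W f" "g' \<in> tensor_class V W g" for f' g'
    using free.span_add[of "f' - f" _ "g' - g"] that
    by (intro tensor_class_eqI) (simp add: mem_tensor_class algebra_simps)
  then have "(\<Union>f' \<in> tensor_class V W f. \<Union>g' \<in> tensor_class V W g. tensor_class V W (f' + g')) =
      (\<Union>f' \<in> tensor_class V W f. \<Union>g' \<in> tensor_class V W g. tensor_class V W (f + g))"
    by (intro SUP_cong refl)
  then show ?thesis by (simp add: tensor_space_def tensor_class_nonempty)
qed

lemma tensor_space_scale:
  "vscale (tensor_space V W N) c (tensor_class V W f) = tensor_class V W (free_scale c f)"
proof -
  have "tensor_class V W (free_scale c f') = tensor_class V W (free_scale c f)"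
    if "f' \<in> tensor_class V W f" for f'
    using free.span_scale[of "f' - f" _ c] that
    by (intro tensor_class_eqI) (simp add: mem_tensor_class free.scale_right_diff_distrib)
  then have "(\<Union>f' \<in> tensor_class V W f. tensor_class V W (free_scale c f')) =
      (\<Union>f' \<in> tensor_class V W f. tensor_class V W (free_scale c f))"
    by (intro SUP_cong refl)
  then show ?thesis by (simp add: tensor_space_def tensor_class_nonempty)
qed

lemma keys_free_scale: "Poly_Mapping.keys (free_scale c f) \<subseteq> Poly_Mapping.keys f"
  by (auto simp: in_keys_iff lookup_free_scale)

lemma subspace_free_on: "free.subspace (free_on V W)"
proof (rule free.subspaceI)
  show "f + g \<in> free_on V W" if "f \<in> free_on V W" "g \<in> free_on V W" for f g
    using that Poly_Mapping.keys_add[of f g] unfolding free_on_def by blast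
  show "free_scale c f \<in> free_on V W" if "f \<in> free_on V W" for c f
    using that keys_free_scale[of c f] unfolding free_on_def by blast
qed (simp add: free_on_def)

text \<open>Modulo the bilinearity relations, the coefficient of a pair can be absorbed into its first
  component.\<close>

lemma exists_represents:
  assumes scale: "\<And>c x. x \<in> carrier V \<Longrightarrow> vscale V c x \<in> carrier V" and f: "f \<in> free_on V W"
  shows "\<exists>zs. represents V W zs (tensor_class V W f)"
proof -
  let ?l = "Poly_Mapping.lookup f"
  obtain ks where ks: "set ks = Poly_Mapping.keys f" "distinct ks"
    using finite_distinct_list[of "Poly_Mapping.keys f"] by auto
  define zs where "zs = map (\<lambda>k. (vscale V (?l k) (fst k), snd k)) ks"
  have kc: "fst k \<in> carrier V" "snd k \<in> carrier W" if "k \<in> Poly_Mapping.keys f" for k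
    using f that by (auto simp: free_on_def)
  have zs_sum: "(\<Sum>(x, y)\<leftarrow>zs. gen x y) = (\<Sum>k\<in>Poly_Mapping.keys f. gen (vscale V (?l k) (fst k)) (snd k))"
    using ks by (simp add: zs_def o_def sum_list_distinct_conv_sum_set)
  have f_sum: "f = (\<Sum>k\<in>Poly_Mapping.keys f. free_scale (?l k) (gen (fst k) (snd k)))"
  proof (rule poly_mapping_eqI)
    fix i
    have "Poly_Mapping.lookup (\<Sum>k\<in>Poly_Mapping.keys f. free_scale (?l k) (gen (fst k) (snd k))) i
        = (\<Sum>k\<in>Poly_Mapping.keys f. if k = i then ?l k else 0)"
      unfolding lookup_sum lookup_free_scale lookup_single by (rule sum.cong) (auto simp: when_def)
    then show "?l i = Poly_Mapping.lookup (\<Sum>k\<in>Poly_Mapping.keys f. free_scale (?l k) (gen (fst k) (snd k))) i"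
      by (simp add: in_keys_iff)
  qed
  have "(\<Sum>(x, y)\<leftarrow>zs. gen x y) - f = (\<Sum>k\<in>Poly_Mapping.keys f.
      gen (vscale V (?l k) (fst k)) (snd k) - free_scale (?l k) (gen (fst k) (snd k)))"
    using arg_cong2[where f = minus, OF zs_sum f_sum] unfolding sum_subtractf .
  also have "\<dots> \<in> free.span (bilinear_relations V W)"
  proof (intro free.span_sum free.span_base)
    fix k assume "k \<in> Poly_Mapping.keys f"
    then show "gen (vscale V (?l k) (fst k)) (snd k) - free_scale (?l k) (gen (fst k) (snd k))
        \<in> bilinear_relations V W"
      using kc unfolding bilinear_relations_def by blast
  qed
  finally have "tensor_class V W f = tensor_class V W (\<Sum>(x, y)\<leftarrow>zs. gen x y)"
    by (rule tensor_class_eqI[symmetric])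
  moreover have "set zs \<subseteq> carrier V \<times> carrier W"
    using kc scale by (auto simp: zs_def ks)
  ultimately show ?thesis by (auto simp: represents_def)
qed


section \<open>The tensor norm as a mid norm\<close>

lemma tendsto_sum_list:
  fixes f :: "'a \<Rightarrow> 'b \<Rightarrow> 'c::topological_monoid_add"
  assumes "\<And>z. z \<in> set zs \<Longrightarrow> (f z \<longlongrightarrow> l z) F"
  shows "((\<lambda>n. \<Sum>z\<leftarrow>zs. f z n) \<longlongrightarrow> (\<Sum>z\<leftarrow>zs. l z)) F"
  using assms by (induction zs) (auto intro!: tendsto_add)

lemma sum_list_sum_swap:
  fixes f :: "'a \<Rightarrow> 'b \<Rightarrow> 'c::comm_monoid_add"
  shows "(\<Sum>i\<in>I. \<Sum>z\<leftarrow>zs. f z i) = (\<Sum>z\<leftarrow>zs. \<Sum>i\<in>I. f z i)"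
  by (induction zs) (auto simp: sum.distrib)

context banach_space_over
begin

abbreviation Lp :: "real \<Rightarrow> ('k, nat \<Rightarrow> 'k) nspace" where "Lp p \<equiv> ell (ennreal p) scalars"

text \<open>The double sum factors into \<open>\<Sum>\<^sub>n |\<phi>\<^sub>n(x)|\<^sup>p\<close> and \<open>\<Sum>\<^sub>j |y(j)|\<^sup>p\<close>.\<close>

lemma mid_norm_elementary_le:
  assumes p: "1 \<le> p" and C: "C \<ge> 0" "\<And>M. (\<Sum>j<M. norm (y j) powr p) \<le> C powr p"
  shows "mid_norm p E (\<lambda>j. scaleK (y j) x) \<le> ennreal (norm x * C)"
proof -
  have "(\<Sum>n<N. \<Sum>j<M. norm (\<phi> n (scaleK (y j) x)) powr p) \<le> (norm x * C) powr p"
    if \<phi>: "\<phi> \<in> weak_ball p" for \<phi> N M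
  proof -
    have "(\<Sum>n<N. \<Sum>j<M. norm (\<phi> n (scaleK (y j) x)) powr p)
        = (\<Sum>n<N. \<Sum>j<M. norm (\<phi> n x) powr p * norm (y j) powr p)"
      by (simp add: dual_E_linear[OF weak_ball_functional[OF \<phi>]] norm_mult powr_mult mult.commute)
    also have "\<dots> = (\<Sum>n<N. norm (\<phi> n x) powr p) * (\<Sum>j<M. norm (y j) powr p)"
      by (simp add: sum_product)
    also have "\<dots> \<le> norm x powr p * C powr p"
      using weak_ball_pointwise[OF p \<phi>] C by (intro mult_mono sum_nonneg) auto
    finally show ?thesis using C by (simp add: powr_mult)
  qed
  then show ?thesis using p C by (simp add: mid_norm_le_iff)
qed

text \<open>A tail of \<open>(y(j) x)\<^sub>j\<close> has the same form with a tail of \<open>y\<close> in place of \<open>y\<close>, so it is bounded by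
  \<open>norm x * R m\<close>, where \<open>R m\<close> is the \<open>\<ell>\<^sub>p\<close>-norm of that tail of \<open>y\<close>.\<close>

lemma elementary_in_ell_mid_u:
  assumes p: "1 \<le> p" and y: "y \<in> carrier (Lp p)"
  shows "(\<lambda>j. scaleK (y j) x) \<in> carrier (ell_mid_u p E)"
proof -
  let ?y = "\<lambda>j. norm (y j) powr p"
  have s: "summable ?y" using y p by (simp add: Lp_mem_iff)
  define R where "R m = suminf (\<lambda>j. ?y (j + m)) powr (1 / p)" for m
  have s': "summable (\<lambda>j. ?y (j + m))" for m using s by (rule summable_ignore_initial_segment)
  have "(\<Sum>j<M. norm (y (m + j)) powr p) \<le> R m powr p" for m M
    using p s'[of m] sum_le_suminf[OF s'[of m], of "{..<M}"]
    by (simp add: R_def powr_powr suminf_nonneg add.commute)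
  then have le: "mid_norm p E (\<lambda>j. scaleK (y (m + j)) x) \<le> ennreal (norm x * R m)" for m
    using p by (intro mid_norm_elementary_le) (auto simp: R_def)
  have R0: "R m \<ge> 0" for m by (simp add: R_def)
  have "R \<longlonglongrightarrow> 0"
  proof -
    have "(\<lambda>m. suminf (\<lambda>j. ?y (j + m)) powr (1 / p)) \<longlonglongrightarrow> 0 powr (1 / p)"
      using p s' by (intro tendsto_powr' suminf_exist_split2 s) (auto simp: suminf_nonneg)
    then show ?thesis by (simp add: R_def[abs_def])
  qed
  then have lim: "(\<lambda>m. norm x * R m) \<longlonglongrightarrow> 0" by (rule tendsto_mult_right_zero)
  have "(\<lambda>m. enn2real (mid_norm p E (\<lambda>j. scaleK (y (m + j)) x))) \<longlonglongrightarrow> 0"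
    by (rule tendsto_sandwich[OF _ _ tendsto_const lim])
       (auto intro!: always_eventually mid_norm_leD(2)[OF le] simp: R0)
  then show ?thesis using mid_norm_leD(1)[OF le[of 0]] R0 by simp
qed

text \<open>The natural map from \<open>E \<otimes> \<ell>\<^sub>p\<close> to sequences in \<open>E\<close>, on representations of tensors.\<close>

definition list_seq :: "('e \<times> (nat \<Rightarrow> 'k)) list \<Rightarrow> nat \<Rightarrow> 'e" where
  "list_seq zs i = (\<Sum>(x, y)\<leftarrow>zs. scaleK (y i) x)"

lemma list_seq_in_ell_mid_u:
  assumes p: "1 \<le> p" and "set zs \<subseteq> UNIV \<times> carrier (Lp p)"
  shows "list_seq zs \<in> carrier (ell_mid_u p E)"
  using assms(2)
proof (induction zs)
  case Nil
  have "mid_norm p E (\<lambda>_. 0) \<le> ennreal 0"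
    using p by (simp add: mid_norm_le_iff dual_E_linear weak_ball_functional del: ennreal_0)
  then show ?case by (simp add: list_seq_def[abs_def])
next
  case (Cons z zs)
  interpret U: normed_nspace "ell_mid_u p E" by (rule normed_nspace_ell_mid_u[OF p])
  have "vadd (ell_mid_u p E) (\<lambda>j. scaleK (snd z j) (fst z)) (list_seq zs) \<in> carrier (ell_mid_u p E)"
    using Cons by (intro U.add_closed elementary_in_ell_mid_u p) auto
  moreover have "list_seq (z # zs) = vadd (ell_mid_u p E) (\<lambda>j. scaleK (snd z j) (fst z)) (list_seq zs)"
    by (auto simp: list_seq_def split_def)
  ultimately show ?case by metis
qed

text \<open>Hoelder's inequality for the double sequence \<open>\<phi>\<^sub>n(x) y(j)\<close>, whose \<open>\<ell>\<^sub>p\<close>-norm is at most \<open>norm x\<close>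
  times that of \<open>y\<close>, bounds all rectangular sums of \<open>|\<psi>\<^sub>n(j) \<phi>\<^sub>n(x) y(j)|\<close>; absolute convergence of the
  outer series follows on letting the width of the rectangles grow.\<close>

lemma summable_functional_pairing:
  assumes p: "1 \<le> p" and y: "y \<in> carrier (Lp p)" and \<phi>: "\<phi> \<in> weak_ball p" and \<psi>: "\<psi> \<in> double_ball p"
  shows "summable (\<lambda>n. \<phi> n x * pairing (\<psi> n) y)"
proof -
  obtain C where C: "C \<ge> 0" "\<And>M. (\<Sum>j<M. norm (y j) powr p) \<le> C powr p"
    using Lp_mem_bound[OF p y] by blast
  note s = summable_pairing[OF p y \<psi>]
  have "(\<Sum>n<N. norm (\<phi> n x * pairing (\<psi> n) y)) \<le> norm x * C" for N
  proof -
    have "(\<Sum>n<N. \<Sum>j<M. norm (\<phi> n x) * norm (\<psi> n j * y j)) \<le> norm x * C" for M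
    proof -
      have "(\<Sum>i\<in>{..<N} \<times> {..<M}. norm (case i of (n, j) \<Rightarrow> \<psi> n j) *
          norm (\<phi> (fst i) x * y (snd i))) \<le> norm x * C"
      proof (rule Holder_finite[OF _ p])
        have "(\<Sum>i\<in>{..<N} \<times> {..<M}. norm (\<phi> (fst i) x * y (snd i)) powr p)
            = (\<Sum>n<N. norm (\<phi> n x) powr p) * (\<Sum>j<M. norm (y j) powr p)"
          by (simp add: sum_product sum.cartesian_product norm_mult powr_mult split_def)
        also have "\<dots> \<le> norm x powr p * C powr p"
          using weak_ball_pointwise[OF p \<phi>] C by (intro mult_mono sum_nonneg) auto
        finally show "(\<Sum>i\<in>{..<N} \<times> {..<M}. norm (\<phi> (fst i) x * y (snd i)) powr p) \<le> (norm x * C) powr p"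
          using C by (simp add: powr_mult)
      qed (use C in \<open>auto intro: conj_ball_of_double_ball[OF p \<psi>]\<close>)
      then show ?thesis
        by (simp add: sum.cartesian_product norm_mult split_def mult_ac)
    qed
    moreover have "(\<lambda>M. \<Sum>n<N. \<Sum>j<M. norm (\<phi> n x) * norm (\<psi> n j * y j))
        \<longlonglongrightarrow> (\<Sum>n<N. norm (\<phi> n x) * suminf (\<lambda>j. norm (\<psi> n j * y j)))"
      unfolding sum_distrib_left[symmetric]
      by (intro tendsto_intros summable_LIMSEQ s)
    ultimately have "(\<Sum>n<N. norm (\<phi> n x) * suminf (\<lambda>j. norm (\<psi> n j * y j))) \<le> norm x * C"
      by (intro LIMSEQ_le_const2) auto
    moreover have "(\<Sum>n<N. norm (\<phi> n x * pairing (\<psi> n) y))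
        \<le> (\<Sum>n<N. norm (\<phi> n x) * suminf (\<lambda>j. norm (\<psi> n j * y j)))"
      unfolding pairing_def norm_mult[of "\<phi> _ x"]
      by (intro sum_mono mult_left_mono summable_norm s) auto
    ultimately show ?thesis by simp
  qed
  then have "summable (\<lambda>n. norm (\<phi> n x * pairing (\<psi> n) y))"
    by (intro summableI_nonneg_bounded) auto
  then show ?thesis by (rule summable_norm_cancel)
qed

lemma functional_list_seq:
  assumes "f \<in> carrier (dual E)"
  shows "f (list_seq zs j) = (\<Sum>(x, y)\<leftarrow>zs. y j * f x)"
  unfolding list_seq_def dual_E_linear(5)[OF assms] map_map
  by (auto intro!: arg_cong[of _ _ sum_list] simp: dual_E_linear[OF assms])

text \<open>The expression \<open>L \<phi> \<psi>\<close> under the supremum is an iterated limit of the rectangular sums in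
  \<open>mid_norm_le_iff_dual\<close>, which gives one inequality. Conversely each rectangular sum is itself
  a value of \<open>L\<close>, namely for \<open>\<psi>\<close> cut off outside the rectangle.\<close>

theorem alpha_of_list_eq_mid_norm:
  assumes p: "1 \<le> p" and zs: "set zs \<subseteq> UNIV \<times> carrier (Lp p)"
  shows "alpha_of_list p E zs = enn2real (mid_norm p E (list_seq zs))"
proof -
  let ?x = "list_seq zs"
  let ?c = "enn2real (mid_norm p E ?x)"
  define L where "L \<phi> \<psi> = (\<Sum>(x, y)\<leftarrow>zs. suminf (\<lambda>n. \<phi> n x * pairing (\<psi> n) y))" for \<phi> \<psi>
  have fin: "mid_norm p E ?x < \<infinity>" using list_seq_in_ell_mid_u[OF p zs] by simp
  \<comment> \<open>finiteness of the mid norm turns its dual description into a bound by a real number\<close>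
  note ub = mid_norm_le_self[OF fin, unfolded mid_norm_le_iff_dual[OF p enn2real_nonneg]]
  have zsD: "snd z \<in> carrier (Lp p)" if "z \<in> set zs" for z using zs that by auto
  \<comment> \<open>on a rectangle the sum over the tensor and the sums over the indices may be exchanged\<close>
  have partial: "(\<Sum>n<N. \<Sum>j<M. \<psi> n j * \<phi> n (?x j))
      = (\<Sum>z\<leftarrow>zs. \<Sum>n<N. \<phi> n (fst z) * (\<Sum>j<M. \<psi> n j * snd z j))"
    if \<phi>: "\<phi> \<in> weak_ball p" for \<phi> \<psi> N M
    by (simp add: functional_list_seq[OF weak_ball_functional[OF \<phi>]] sum_list_const_mult[symmetric]
        sum_list_sum_swap sum_distrib_left split_def mult_ac)
  have upper: "norm (L \<phi> \<psi>) \<le> ?c" if \<phi>: "\<phi> \<in> weak_ball p" and \<psi>: "\<psi> \<in> double_ball p" for \<phi> \<psi>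
  proof -
    have "norm (\<Sum>z\<leftarrow>zs. \<Sum>n<N. \<phi> n (fst z) * pairing (\<psi> n) (snd z)) \<le> ?c" for N
    proof (rule LIMSEQ_le_const2)
      show "(\<lambda>M. norm (\<Sum>n<N. \<Sum>j<M. \<psi> n j * \<phi> n (?x j)))
          \<longlonglongrightarrow> norm (\<Sum>z\<leftarrow>zs. \<Sum>n<N. \<phi> n (fst z) * pairing (\<psi> n) (snd z))"
        unfolding partial[OF \<phi>] pairing_def
      proof (rule tendsto_norm, rule tendsto_sum_list, rule tendsto_sum)
        fix z n assume "z \<in> set zs"
        then have "summable (\<lambda>j. \<psi> n j * snd z j)"
          by (intro summable_norm_cancel[OF summable_pairing[OF p _ \<psi>]] zsD)
        then show "(\<lambda>M. \<phi> n (fst z) * (\<Sum>j<M. \<psi> n j * snd z j))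
            \<longlonglongrightarrow> \<phi> n (fst z) * suminf (\<lambda>j. \<psi> n j * snd z j)"
          by (intro tendsto_mult tendsto_const summable_LIMSEQ)
      qed
    qed (use ub \<phi> \<psi> in blast)
    moreover have "(\<lambda>N. \<Sum>z\<leftarrow>zs. \<Sum>n<N. \<phi> n (fst z) * pairing (\<psi> n) (snd z)) \<longlonglongrightarrow> L \<phi> \<psi>"
      unfolding L_def split_def
      by (intro tendsto_sum_list summable_LIMSEQ summable_functional_pairing[OF p _ \<phi> \<psi>] zsD)
    ultimately show ?thesis
      by (intro LIMSEQ_le_const2[OF tendsto_norm]) auto
  qed
  have alpha: "alpha_of_list p E zs = (SUP (\<phi>, \<psi>)\<in>weak_ball p \<times> double_ball p. norm (L \<phi> \<psi>))"
    by (simp add: alpha_of_list_def L_def)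
  have bdd: "bdd_above ((\<lambda>(\<phi>, \<psi>). norm (L \<phi> \<psi>)) ` (weak_ball p \<times> double_ball p))"
    by (intro bdd_aboveI[of _ ?c]) (auto intro: upper)
  have empty: "conj_ball p ({..<0::nat} \<times> {..<0::nat}) (\<lambda>_. 0 :: 'k)"
    by (simp add: conj_ball_def)
  have nonempty: "(double_ball p :: (nat \<Rightarrow> nat \<Rightarrow> 'k) set) \<noteq> {}"
    using double_ball_of_conj_ball[OF p empty] by blast
  then have le: "alpha_of_list p E zs \<le> ?c"
    unfolding alpha using weak_ball_nonempty[OF p] by (intro cSUP_least) (auto intro: upper)
  moreover have lower: "norm (\<Sum>n<N. \<Sum>j<M. \<psi> n j * \<phi> n (?x j)) \<le> alpha_of_list p E zs"
    if \<phi>: "\<phi> \<in> weak_ball p" and \<psi>: "\<psi> \<in> double_ball p" for \<phi> \<psi> N M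
  proof -
    define \<psi>' where "\<psi>' n j = (if n < N \<and> j < M then \<psi> n j else 0)" for n j
    have \<psi>': "\<psi>' \<in> double_ball p"
      using double_ball_of_conj_ball[OF p conj_ball_of_double_ball[OF p \<psi>]]
      unfolding \<psi>'_def[abs_def] prod.case .
    have pair: "pairing (\<psi>' n) y = (if n < N then \<Sum>j<M. \<psi> n j * y j else 0)" for n y
      unfolding pairing_def by (subst suminf_finite[of "{..<M}"]) (auto simp: \<psi>'_def)
    have "suminf (\<lambda>n. \<phi> n x * pairing (\<psi>' n) y) = (\<Sum>n<N. \<phi> n x * (\<Sum>j<M. \<psi> n j * y j))" for x y
      unfolding pair by (subst suminf_finite[of "{..<N}"]) auto
    then have "(\<Sum>n<N. \<Sum>j<M. \<psi> n j * \<phi> n (?x j)) = L \<phi> \<psi>'"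
      by (simp add: L_def partial[OF \<phi>] split_def)
    moreover have "norm (L \<phi> \<psi>') \<le> alpha_of_list p E zs"
      using cSUP_upper[OF _ bdd, of "(\<phi>, \<psi>')"] \<phi> \<psi>' by (simp add: alpha)
    ultimately show ?thesis by simp
  qed
  moreover have nonneg: "0 \<le> alpha_of_list p E zs"
  proof -
    obtain \<phi> \<psi> where "\<phi> \<in> weak_ball p" "(\<psi> :: nat \<Rightarrow> nat \<Rightarrow> 'k) \<in> double_ball p"
      using weak_ball_nonempty[OF p] nonempty by blast
    from lower[OF this, of 0 0] show ?thesis by simp
  qed
  ultimately have "mid_norm p E ?x \<le> ennreal (alpha_of_list p E zs)"
    using p by (subst mid_norm_le_iff_dual) auto
  then have "?c \<le> alpha_of_list p E zs" using nonneg by (rule mid_norm_leD)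
  with le show ?thesis by simp
qed

text \<open>The same map on the free vector space over pairs. It factors through the tensor product
  (\<open>tensor_seq_class\<close>) and agrees with \<open>list_seq\<close> on representations (\<open>represents_list_seq\<close>).\<close>

definition tensor_seq :: "(('e \<times> (nat \<Rightarrow> 'k)) \<Rightarrow>\<^sub>0 'k) \<Rightarrow> nat \<Rightarrow> 'e" where
  "tensor_seq f i = (\<Sum>k\<in>Poly_Mapping.keys f. scaleK (Poly_Mapping.lookup f k * snd k i) (fst k))"

lemma tensor_seq_superset:
  assumes "finite S" "Poly_Mapping.keys f \<subseteq> S"
  shows "tensor_seq f i = (\<Sum>k\<in>S. scaleK (Poly_Mapping.lookup f k * snd k i) (fst k))"
  unfolding tensor_seq_def using assms by (intro sum.mono_neutral_left) (auto simp: in_keys_iff)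

lemma tensor_seq_add: "tensor_seq (f + g) i = tensor_seq f i + tensor_seq g i"
  using Poly_Mapping.keys_add[of f g]
  by (simp add: tensor_seq_superset[of "Poly_Mapping.keys f \<union> Poly_Mapping.keys g"]
      lookup_add distrib_right scale_left_distrib sum.distrib)

lemma tensor_seq_scale: "tensor_seq (free_scale c f) i = scaleK c (tensor_seq f i)"
  by (simp add: tensor_seq_superset[of "Poly_Mapping.keys f"] keys_free_scale lookup_free_scale
      scale_sum_right mult.assoc)

lemma tensor_seq_gen [simp]: "tensor_seq (gen x y) i = scaleK (y i) x"
  by (simp add: tensor_seq_def)

lemma tensor_seq_diff: "tensor_seq (f - g) i = tensor_seq f i - tensor_seq g i"
  using tensor_seq_add[of "f - g" g i] by simp

lemma tensor_seq_zero [simp]: "tensor_seq 0 i = 0"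
  by (simp add: tensor_seq_def)

lemma tensor_seq_sum: "tensor_seq (sum F I) i = (\<Sum>k\<in>I. tensor_seq (F k) i)"
  by (induction I rule: infinite_finite_induct) (auto simp: tensor_seq_add)

lemma tensor_seq_list: "tensor_seq (\<Sum>(x, y)\<leftarrow>zs. gen x y) = list_seq zs"
proof
  fix i
  show "tensor_seq (\<Sum>(x, y)\<leftarrow>zs. gen x y) i = list_seq zs i"
    by (induction zs) (auto simp: tensor_seq_add list_seq_def)
qed

lemma tensor_seq_span_zero:
  assumes "r \<in> free.span (bilinear_relations E (ell q scalars))"
  shows "tensor_seq r i = 0"
proof -
  have "bilinear_relations E (ell q scalars) \<subseteq> {f. \<forall>i. tensor_seq f i = 0}"
    by (auto simp: bilinear_relations_def tensor_seq_diff tensor_seq_scale ell_def seq_space_def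
        scale_right_distrib scale_left_distrib mult.commute)
  moreover have "free.subspace {f. \<forall>i. tensor_seq f i = 0}"
    by (auto simp: free.subspace_def tensor_seq_add tensor_seq_scale)
  ultimately show ?thesis using assms free.span_minimal by blast
qed

lemma tensor_seq_class:
  "g \<in> tensor_class E (ell q scalars) f \<Longrightarrow> tensor_seq g = tensor_seq f"
  using tensor_seq_span_zero[of "g - f"] by (auto simp: mem_tensor_class tensor_seq_diff fun_eq_iff)

lemma represents_list_seq:
  assumes "represents E (ell q scalars) zs (tensor_class E (ell q scalars) f)"
  shows "set zs \<subseteq> UNIV \<times> carrier (ell q scalars)" "list_seq zs = tensor_seq f"
proof -
  show "set zs \<subseteq> UNIV \<times> carrier (ell q scalars)" using assms by (simp add: represents_def)
  have "f \<in> tensor_class E (ell q scalars) (\<Sum>(x, y)\<leftarrow>zs. gen x y)"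
    using assms tensor_class_self[of f] by (auto simp: represents_def)
  then show "list_seq zs = tensor_seq f" using tensor_seq_class tensor_seq_list by metis
qed

lemma tensor_seq_in_ell_mid_u:
  assumes p: "1 \<le> p" and f: "f \<in> free_on E (Lp p)"
  shows "tensor_seq f \<in> carrier (ell_mid_u p E)"
proof -
  obtain zs where "represents E (Lp p) zs (tensor_class E (Lp p) f)"
    using exists_represents[OF _ f] by auto
  from represents_list_seq[OF this] list_seq_in_ell_mid_u[OF p] show ?thesis by metis
qed

text \<open>Whatever representation the choice operator in the definition of \<open>alpha\<close> returns, its image under
  \<open>list_seq\<close> is \<open>tensor_seq f\<close>, and \<open>alpha_of_list\<close> depends on this image alone.\<close>

lemma alpha_tensor_class:
  assumes p: "1 \<le> p" and f: "f \<in> free_on E (Lp p)"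
  shows "alpha p E (tensor_class E (Lp p) f) = enn2real (mid_norm p E (tensor_seq f))"
proof -
  define zs where "zs = (SOME zs. represents E (Lp p) zs (tensor_class E (Lp p) f))"
  have "\<exists>zs. represents E (Lp p) zs (tensor_class E (Lp p) f)"
    using exists_represents[OF _ f] by auto
  then have "represents E (Lp p) zs (tensor_class E (Lp p) f)" unfolding zs_def by (rule someI_ex)
  from represents_list_seq[OF this] show ?thesis
    using alpha_of_list_eq_mid_norm[OF p, of zs] by (simp add: alpha_def zs_def)
qed

text \<open>The error is a tail of \<open>- x\<close> preceded by zeros, so that its norm tends to zero by the condition that
  singles out \<open>ell_mid_u\<close> among all mid summable sequences.\<close>

lemma truncations_converge:
  assumes p: "1 \<le> p" and x: "x \<in> carrier (ell_mid_u p E)"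
  shows "(\<lambda>n. vdist (ell_mid_u p E) (\<lambda>i. if i < n then x i else 0) x) \<longlonglongrightarrow> 0"
proof (rule tendsto_sandwich[OF _ _ tendsto_const])
  show "(\<lambda>n. enn2real (mid_norm p E (\<lambda>j. x (n + j)))) \<longlonglongrightarrow> 0" using x by simp
  have "vdist (ell_mid_u p E) (\<lambda>i. if i < n then x i else 0) x \<le> enn2real (mid_norm p E (\<lambda>j. x (n + j)))" for n
  proof -
    have "mid_norm p E (\<lambda>j. x (n + j)) < \<infinity>"
      using x mid_norm_leD(1)[OF mid_norm_tail_le[OF p enn2real_nonneg mid_norm_le_self]] by simp
    note mid_norm_drop_le[OF p enn2real_nonneg mid_norm_le_self[OF this]]
    from mid_norm_scale_le[OF p enn2real_nonneg this, of "- 1"]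
    have "mid_norm p E (\<lambda>j. scaleK (- 1) (if j < n then 0 else x j))
        \<le> ennreal (enn2real (mid_norm p E (\<lambda>j. x (n + j))))" by simp
    moreover have "(\<lambda>j. (if j < n then x j else 0) + scaleK (- 1) (x j)) =
        (\<lambda>j. scaleK (- 1) (if j < n then 0 else x j))"
      by (auto simp: scaleK_minus_one)
    ultimately show ?thesis
      using mid_norm_leD(2)[OF _ enn2real_nonneg] by (simp add: vdist_def)
  qed
  then show "\<forall>\<^sub>F n in sequentially. vdist (ell_mid_u p E) (\<lambda>i. if i < n then x i else 0) x
      \<le> enn2real (mid_norm p E (\<lambda>j. x (n + j)))" by (intro always_eventually) simp
qed (simp add: vdist_def)

text \<open>The tensor is \<open>x\<^sub>0 \<otimes> e\<^sub>0 + \<dots> + x\<^sub>n\<^sub>-\<^sub>1 \<otimes> e\<^sub>n\<^sub>-\<^sub>1\<close> with the unit vectors \<open>e\<^sub>j\<close> of \<open>\<ell>\<^sub>p\<close>.\<close>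

lemma truncation_is_tensor:
  assumes p: "1 \<le> p"
  shows "\<exists>f\<in>free_on E (Lp p). tensor_seq f = (\<lambda>i. if i < n then x i else 0)"
proof -
  define e :: "nat \<Rightarrow> nat \<Rightarrow> 'k" where "e j i = (if i = j then 1 else 0)" for i j
  have e: "e j \<in> carrier (Lp p)" for j
  proof -
    have "(\<lambda>i. norm (e j i) powr p) = (\<lambda>i. if i = j then 1 else 0)" by (auto simp: e_def)
    then show ?thesis using p by (simp add: Lp_mem_iff)
  qed
  have "(\<Sum>j<n. gen (x j) (e j)) \<in> free_on E (Lp p)"
    by (intro free.subspace_sum subspace_free_on) (simp add: free_on_def e)
  moreover have "tensor_seq (\<Sum>j<n. gen (x j) (e j)) = (\<lambda>i. if i < n then x i else 0)"
  proof
    fix i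
    have "tensor_seq (\<Sum>j<n. gen (x j) (e j)) i = (\<Sum>j<n. if i = j then x j else 0)"
      unfolding tensor_seq_sum tensor_seq_gen by (rule sum.cong) (auto simp: e_def)
    then show "tensor_seq (\<Sum>j<n. gen (x j) (e j)) i = (if i < n then x i else 0)" by simp
  qed
  ultimately show ?thesis by blast
qed

end

theorem theorem5p2:
  fixes scaleK :: "'k::real_or_complex \<Rightarrow> 'e::banach \<Rightarrow> 'e"
    and p :: real
  assumes "banach_space_over scaleK"
    and "1 \<le> p"
  shows "isometrically_isomorphic (ell_mid_u p (nspace_of scaleK))
           (completion_of (alpha_tensor p (nspace_of scaleK)))"
proof -
  interpret banach_space_over scaleK by fact
  note p = \<open>1 \<le> p\<close>
  let ?X = "ell_mid_u p E" and ?W = "alpha_tensor p E" and ?cl = "tensor_class E (Lp p)"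
  interpret X: normed_nspace ?X by (rule normed_nspace_ell_mid_u[OF p])
  \<comment> \<open>all members of a coset have the same image, so the choice is immaterial\<close>
  define j where "j u = tensor_seq (SOME f. f \<in> u)" for u
  have j: "j (?cl f) = tensor_seq f" for f
    unfolding j_def by (rule tensor_seq_class[OF someI, OF tensor_class_self])
  note W = alpha_tensor_def tensor_space_add tensor_space_scale
  have add: "f + g \<in> free_on E (Lp p)" if "f \<in> free_on E (Lp p)" "g \<in> free_on E (Lp p)" for f g
    using free.subspace_add[OF subspace_free_on that] .
  have scale: "free_scale c f \<in> free_on E (Lp p)" if "f \<in> free_on E (Lp p)" for c f
    using free.subspace_scale[OF subspace_free_on that] .
  show ?thesis
  proof (rule X.isometric_completion)
    fix s assume "s \<in> cauchy_seqs ?X"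
    then show "\<exists>x\<in>carrier ?X. (\<lambda>n. vdist ?X (s n) x) \<longlonglongrightarrow> 0" by (rule ell_mid_u_complete[OF p])
  next
    fix u v assume "u \<in> carrier ?W" "v \<in> carrier ?W"
    then obtain f g where "f \<in> free_on E (Lp p)" "u = ?cl f" "g \<in> free_on E (Lp p)" "v = ?cl g"
      by (auto simp: W)
    then show "vadd ?W u v \<in> carrier ?W" "j (vadd ?W u v) = vadd ?X (j u) (j v)"
      by (auto simp: W j tensor_seq_add add)
  next
    fix c u assume "u \<in> carrier ?W"
    then obtain f where "f \<in> free_on E (Lp p)" "u = ?cl f" by (auto simp: W)
    then show "vscale ?W c u \<in> carrier ?W" "j (vscale ?W c u) = vscale ?X c (j u)"
      by (auto simp: W j tensor_seq_scale scale)
  next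
    fix u assume "u \<in> carrier ?W"
    then obtain f where f: "f \<in> free_on E (Lp p)" "u = ?cl f" by (auto simp: W)
    then show "j u \<in> carrier ?X"
      using tensor_seq_in_ell_mid_u[OF p] by (simp only: j)
    show "vnorm ?W u = vnorm ?X (j u)"
      using f alpha_tensor_class[OF p] by (simp add: W j)
  next
    fix x assume x: "x \<in> carrier ?X"
    have "\<forall>n. \<exists>f. f \<in> free_on E (Lp p) \<and> tensor_seq f = (\<lambda>i. if i < n then x i else 0)"
      using truncation_is_tensor[OF p] by blast
    from choice[OF this] obtain F where F: "\<And>n. F n \<in> free_on E (Lp p)"
      "\<And>n. tensor_seq (F n) = (\<lambda>i. if i < n then x i else 0)" by blast
    show "\<exists>s. range s \<subseteq> carrier ?W \<and> (\<lambda>n. vdist ?X (j (s n)) x) \<longlonglongrightarrow> 0"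
      using truncations_converge[OF p x] F
      by (intro exI[of _ "\<lambda>n. ?cl (F n)"]) (auto simp: W j)
  qed
qed

end
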